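(* Every crowded Tychonov space $X$ has a crowded Tychonov nowhere constant continuous image $Y$ of weight $w(Y)\le \widehat{c}(X)$. Moreover, in this statement $\le$ may be replaced with $<$ if and only if there are no $\widehat{c}(X)$-Suslin lines; that is, for every uncountable regular cardinal $\kappa$ the following are equivalent: (i) every crowded Tychonov space $X$ with $\widehat{c}(X)=\kappa$ has a crowded Tychonov nowhere constant continuous image $Y$ with $w(Y)<\kappa$; (ii) there is no $\kappa$-Suslin line (equivalently, there is no $\kappa$-Suslin tree).
   Context: A space is crowded if it has no isolated points. A continuous map $f:X\to Y$ is nowhere constant if $|f[U]|>1$ for every non-empty open $U\subseteq X$; $Y$ is a nowhere constant continuous image of $X$ if there is a nowhere constant continuous surjection $X\to Y$. $w(Y)$ is the weight of $Y$ (minimum cardinality of a base). $\widehat{c}(X)$ is the smallest cardinal $\kappa$ such that there is no family of $\kappa$ many pairwise disjoint non-empty open subsets of $X$ (for every non-empty crowded Hausdorff space it is an uncountable regular cardinal). For an uncountable regular cardinal $\kappa$, a $\kappa$-Suslin line is a crowded linearly ordered topological space $L$ with $\widehat{c}(L)=\kappa\le d(L)$, where $d$ denotes density (minimum cardinality of a dense subset); a $\kappa$-Suslin tree is a tree of height $\kappa$ in which all chains and all antichains have cardinality $<\kappa$. *)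

theory Defs
  imports "HOL-Analysis.Analysis"
begin

unbundle cardinal_syntax
no_notation elt_set_eq (infix \<open>=o\<close> 50)

text \<open>Cardinals are the library's \<^const>\<open>Card_order\<close> relations, compared across types by \<open>\<le>o\<close>, \<open><o\<close>, \<open>=o\<close>.
  The cardinal functions below are least cardinals with a given property. They are determined
  only up to \<open>=o\<close>, and each lives on a type that is large enough for the least cardinal (among
  cardinals of all types) to be represented there; see the lemmas that follow each definition.\<close>

definition least_card :: "('b rel \<Rightarrow> bool) \<Rightarrow> 'b rel" where
  "least_card P =
     (SOME r. Card_order r \<and> P r \<and> (\<forall>r'. Card_order r' \<and> P r' \<longrightarrow> r \<le>o r'))"

lemma least_card:
  assumes "Card_order r0" "P r0"
  shows "Card_order (least_card P)" "P (least_card P)"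
    and "\<And>r. Card_order r \<Longrightarrow> P r \<Longrightarrow> least_card P \<le>o r"
proof -
  have "\<exists>r \<in> {r. Card_order r \<and> P r}. \<forall>r' \<in> {r. Card_order r \<and> P r}. r \<le>o r'"
    by (rule exists_minim_Card_order) (use assms in auto)
  then have "\<exists>r. Card_order r \<and> P r \<and> (\<forall>r'. Card_order r' \<and> P r' \<longrightarrow> r \<le>o r')"
    by blast
  from someI_ex[OF this]
  show "Card_order (least_card P)" "P (least_card P)"
    and "\<And>r. Card_order r \<Longrightarrow> P r \<Longrightarrow> least_card P \<le>o r"
    unfolding least_card_def by blast+
qed

definition base_of :: "'a topology \<Rightarrow> 'a set set \<Rightarrow> bool" where
  "base_of X B \<longleftrightarrow> (\<forall>V\<in>B. openin X V) \<and>
     (\<forall>U x. openin X U \<and> x \<in> U \<longrightarrow> (\<exists>V\<in>B. x \<in> V \<and> V \<subseteq> U))"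

definition weight :: "'a topology \<Rightarrow> 'a set rel" where
  "weight X = least_card (\<lambda>r. \<exists>B. base_of X B \<and> |B| =o r)"

definition dense_subset :: "'a topology \<Rightarrow> 'a set \<Rightarrow> bool" where
  "dense_subset X D \<longleftrightarrow> D \<subseteq> topspace X \<and> X closure_of D = topspace X"

definition density :: "'a topology \<Rightarrow> 'a rel" where
  "density X = least_card (\<lambda>r. \<exists>D. dense_subset X D \<and> |D| =o r)"

definition cellular_family :: "'a topology \<Rightarrow> 'a set set \<Rightarrow> bool" where
  "cellular_family X F \<longleftrightarrow> (\<forall>U\<in>F. openin X U \<and> U \<noteq> {}) \<and> pairwise disjnt F"

definition chat :: "'a topology \<Rightarrow> 'a set rel" where
  "chat X = least_card (\<lambda>r. \<not> (\<exists>F. cellular_family X F \<and> |F| =o r))"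

lemma weight:
  shows "Card_order (weight X)" "\<exists>B. base_of X B \<and> |B| =o weight X"
    and "\<And>B. base_of X B \<Longrightarrow> weight X \<le>o |B|"
proof -
  let ?P = "\<lambda>r. \<exists>B. base_of X B \<and> |B| =o r"
  have "base_of X {U. openin X U}"
    by (auto simp: base_of_def)
  then have *: "?P |{U. openin X U}|"
    using card_of_refl by blast
  show "Card_order (weight X)" "?P (weight X)"
    unfolding weight_def using least_card(1,2)[of _ ?P, OF card_of_Card_order *] by auto
  show "weight X \<le>o |B|" if "base_of X B" for B
    unfolding weight_def
    using least_card(3)[of _ ?P, OF card_of_Card_order * card_of_Card_order] that card_of_refl
    by blast
qed

lemma density:
  shows "Card_order (density X)" "\<exists>D. dense_subset X D \<and> |D| =o density X"
    and "\<And>D. dense_subset X D \<Longrightarrow> density X \<le>o |D|"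
proof -
  let ?P = "\<lambda>r. \<exists>D. dense_subset X D \<and> |D| =o r"
  have "dense_subset X (topspace X)"
    by (auto simp: dense_subset_def)
  then have *: "?P |topspace X|"
    using card_of_refl by blast
  show "Card_order (density X)" "?P (density X)"
    unfolding density_def using least_card(1,2)[of _ ?P, OF card_of_Card_order *] by auto
  show "density X \<le>o |D|" if "dense_subset X D" for D
    unfolding density_def
    using least_card(3)[of _ ?P, OF card_of_Card_order * card_of_Card_order] that card_of_refl
    by blast
qed

lemma cellular_family_card:
  assumes "cellular_family X F"
  shows "|F| \<le>o |topspace X|"
proof -
  define f where "f U = (SOME x. x \<in> U)" for U :: "'a set"
  have f: "f U \<in> U" if "U \<in> F" for U
    using assms that some_in_eq unfolding cellular_family_def f_def by blast
  have "inj_on f F"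
  proof (rule inj_onI, rule ccontr)
    fix U V assume "U \<in> F" "V \<in> F" "f U = f V" "U \<noteq> V"
    then show False
      using assms f[of U] f[of V]
      unfolding cellular_family_def pairwise_def disjnt_def by auto
  qed
  moreover have "f ` F \<subseteq> topspace X"
    using f assms openin_subset unfolding cellular_family_def by blast
  ultimately show ?thesis
    using card_of_ordLeq by blast
qed

lemma chat:
  fixes X :: "'a topology"
  shows "Card_order (chat X)" "\<not> (\<exists>F. cellular_family X F \<and> |F| =o chat X)"
    and "\<And>\<kappa> :: 'k rel. Card_order \<kappa> \<Longrightarrow> \<not> (\<exists>F. cellular_family X F \<and> |F| =o \<kappa>) \<Longrightarrow> chat X \<le>o \<kappa>"
proof -
  let ?P = "\<lambda>r :: 'a set rel. \<not> (\<exists>F. cellular_family X F \<and> |F| =o r)"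
  have *: "?P |UNIV :: 'a set set|"
  proof
    assume "\<exists>F. cellular_family X F \<and> |F| =o |UNIV :: 'a set set|"
    then obtain F where F: "cellular_family X F" "|F| =o |UNIV :: 'a set set|" by blast
    have "|F| \<le>o |UNIV :: 'a set|"
      by (rule ordLeq_transitive[OF cellular_family_card[OF F(1)]]) (simp add: card_of_mono1)
    moreover have "|UNIV :: 'a set| <o |UNIV :: 'a set set|"
      using card_of_Pow[of "UNIV :: 'a set"] by simp
    ultimately show False
      using not_ordLess_ordIso[OF ordLeq_ordLess_trans] F(2) by blast
  qed
  show c: "Card_order (chat X)" and "?P (chat X)"
    unfolding chat_def using least_card(1,2)[of _ ?P, OF card_of_Card_order *] by auto
  show "chat X \<le>o \<kappa>"
    if \<kappa>: "Card_order \<kappa>" "\<not> (\<exists>F. cellular_family X F \<and> |F| =o \<kappa>)" for \<kappa> :: "'k rel"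
  proof (rule ccontr)
    assume "\<not> chat X \<le>o \<kappa>"
    then have less: "\<kappa> <o chat X"
      using not_ordLeq_iff_ordLess[of \<kappa> "chat X"] c \<kappa>(1) by (simp add: card_order_on_def)
    then have "|Field \<kappa>| \<le>o |Field (chat X)|"
      using card_of_mono2 ordLess_imp_ordLeq by blast
    then obtain g :: "'k \<Rightarrow> 'a set" where "inj_on g (Field \<kappa>)"
      using card_of_ordLeq[of "Field \<kappa>" "Field (chat X)"] by blast
    then have "|g ` Field \<kappa>| =o |Field \<kappa>|"
      by (rule ordIso_symmetric[OF card_of_ordIsoI[OF inj_on_imp_bij_betw]])
    then have eq: "|g ` Field \<kappa>| =o \<kappa>"
      using card_of_Field_ordIso[OF \<kappa>(1)] ordIso_transitive by blast
    then have "?P |g ` Field \<kappa>|"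
      using \<kappa>(2) ordIso_transitive by blast
    then have "chat X \<le>o |g ` Field \<kappa>|"
      unfolding chat_def using least_card(3)[of _ ?P, OF card_of_Card_order * card_of_Card_order]
      by blast
    then show False
      using not_ordLess_ordLeq[OF ordIso_ordLess_trans[OF eq less]] by blast
  qed
qed

definition crowded :: "'a topology \<Rightarrow> bool" where
  "crowded X \<longleftrightarrow> (\<forall>x\<in>topspace X. \<not> openin X {x})"

definition tychonov :: "'a topology \<Rightarrow> bool" where
  "tychonov X \<longleftrightarrow> completely_regular_space X \<and> Hausdorff_space X"

definition nowhere_constant :: "'a topology \<Rightarrow> ('a \<Rightarrow> 'b) \<Rightarrow> bool" where
  "nowhere_constant X f \<longleftrightarrow> (\<forall>U. openin X U \<and> U \<noteq> {} \<longrightarrow> \<not> f constant_on U)"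

definition nowhere_constant_image :: "'a topology \<Rightarrow> 'b topology \<Rightarrow> bool" where
  "nowhere_constant_image X Y \<longleftrightarrow>
     (\<exists>f. continuous_map X Y f \<and> f ` topspace X = topspace Y \<and> nowhere_constant X f)"

text \<open>A linear order is a reflexive relation \<open>r\<close> with carrier \<^term>\<open>Field r\<close>. The carrier itself
  is included among the generators so that it is the whole space even when there are no
  proper open rays.\<close>

definition order_topology_of :: "'a rel \<Rightarrow> 'a topology" where
  "order_topology_of r = topology_generated_by
     ({Field r} \<union> {{x. (x, a) \<in> r \<and> x \<noteq> a} |a. a \<in> Field r}
                \<union> {{x. (a, x) \<in> r \<and> x \<noteq> a} |a. a \<in> Field r})"

lemma topspace_order_topology_of: "topspace (order_topology_of r) = Field r"
  by (auto simp: order_topology_of_def Field_def)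

definition Suslin_line :: "'k rel \<Rightarrow> 'a rel \<Rightarrow> bool" where
  "Suslin_line \<kappa> r \<longleftrightarrow> Linear_order r \<and> crowded (order_topology_of r) \<and>
     chat (order_topology_of r) =o \<kappa> \<and> \<kappa> \<le>o density (order_topology_of r)"

definition is_tree :: "'a rel \<Rightarrow> bool" where
  "is_tree r \<longleftrightarrow> Partial_order r \<and> (\<forall>t\<in>Field r. well_order_on (underS r t) (Restr r (underS r t)))"

text \<open>Ordinals are well-order relations up to \<open>=o\<close>. The level of height \<open>\<alpha>\<close> consists of the nodes
  whose strict predecessors have order type \<open>\<alpha>\<close>; the height of a tree is the least ordinal whose
  level is empty. All ordinals below \<open>\<alpha> :: 'k rel\<close> are represented on \<open>'k\<close>.\<close>

definition tree_level :: "'a rel \<Rightarrow> 'k rel \<Rightarrow> 'a set" where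
  "tree_level r \<alpha> = {t \<in> Field r. Restr r (underS r t) =o \<alpha>}"

definition has_height :: "'a rel \<Rightarrow> 'k rel \<Rightarrow> bool" where
  "has_height r \<alpha> \<longleftrightarrow> Well_order \<alpha> \<and> tree_level r \<alpha> = {} \<and>
     (\<forall>\<beta> :: 'k rel. \<beta> <o \<alpha> \<longrightarrow> tree_level r \<beta> \<noteq> {})"

definition antichain_in :: "'a rel \<Rightarrow> 'a set \<Rightarrow> bool" where
  "antichain_in r A \<longleftrightarrow> A \<subseteq> Field r \<and> (\<forall>s\<in>A. \<forall>t\<in>A. s \<noteq> t \<longrightarrow> (s, t) \<notin> r)"

definition Suslin_tree :: "'k rel \<Rightarrow> 'a rel \<Rightarrow> bool" where
  "Suslin_tree \<kappa> r \<longleftrightarrow> is_tree r \<and> has_height r \<kappa> \<and>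
     (\<forall>C \<in> Chains r. |C| <o \<kappa>) \<and> (\<forall>A. antichain_in r A \<longrightarrow> |A| <o \<kappa>)"

text \<open>The statement about these notions is made for one arbitrary type \<open>'a\<close> that carries the spaces,
  the lines and the trees (but not the cardinal \<open>\<kappa>\<close>). For images of \<open>X\<close> this loses nothing, as
  the image of a space on \<open>'a\<close> can be copied onto a subset of \<open>'a\<close>. An equivalence that holds
  on each type \<open>'a\<close> separately gives the equivalence for spaces, lines and trees of
  arbitrary types.\<close>

definition uncountable_regular :: "'k rel \<Rightarrow> bool" where
  "uncountable_regular \<kappa> \<longleftrightarrow> Card_order \<kappa> \<and> natLeq <o \<kappa> \<and> regularCard \<kappa>"

end

theory Submission
  imports Defs
begin

text \<open>Choose for every non-empty open \<open>U\<close> a continuous real function \<open>g U\<close> that is not constant on \<open>U\<close>.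
  Starting from the whole space, replace an open set \<open>U\<close> by the interiors of the fibres of \<open>g U\<close> in
  \<open>U\<close>, and take interiors of intersections at limits. The sets that arise form a tree under reverse
  inclusion. Its antichains are cellular families. A chain has at most as many members as a cellular
  family, because \<open>g U\<close> takes a single value on all members below \<open>U\<close>, and the part of \<open>U\<close> where it
  takes another value is open and non-empty. No non-empty open set has all the functions \<open>g U\<close> of the
  tree constant on it, so these functions map \<open>X\<close> onto a nowhere constant image in a cube whose dimension is
  the number of nodes. That number is at most \<open>\<kappa>\<close>, and less than \<open>\<kappa>\<close> unless the tree is \<open>\<kappa>\<close>-Suslin.

  Conversely, order a \<open>\<kappa>\<close>-Suslin tree lexicographically and identify points with fewer than \<open>\<kappa>\<close>
  points between them; the result is a \<open>\<kappa>\<close>-Suslin line. Finally, a nowhere constant map from a linearly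
  ordered space to a space of weight less than \<open>\<kappa>\<close> cuts the line at fewer than \<open>\<kappa>\<close> places that split
  every interval, which gives a dense set of size less than \<open>\<kappa>\<close>.\<close>

section \<open>The tree of cells\<close>

text \<open>The three statements form a cycle: without a tree there are small images, small images
  rule out a line, and every tree yields a line. The cycle has to close on one type, which shapes
  the constructions: an image has representatives of the fibres as points, and the line consists of
  nodes of the tree, not of its branches. The given tree is not pruned first. Cones with fewer than
  \<kappa> nodes and neighbours with nothing between them would spoil the line; both disappear when
  close points are identified. What remains is to see that a class of close points is itself small.
  Small intervals alone do not give this, because a class might have large cofinality; the bounds on
  chains and antichains enter here again, together with the regularity of \<kappa>.\<close>

lemma not_ordLess_card: "Card_order \<kappa> \<Longrightarrow> \<not> |A| <o \<kappa> \<longleftrightarrow> \<kappa> \<le>o |A|"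
  using not_ordLess_iff_ordLeq[of \<kappa> "|A|"] by (simp add: card_order_on_def card_of_Well_order)

text \<open>\<open>chat\<close> only excludes families of exactly that size. The exclusion passes to
  larger families because every subfamily of a cellular family is cellular.\<close>

lemma cellular_less_chat:
  assumes "cellular_family X F"
  shows "|F| <o chat X"
proof (rule ccontr)
  assume "\<not> |F| <o chat X"
  then have "chat X \<le>o |F|"
    using not_ordLess_card chat(1) by blast
  then have "|Field (chat X)| \<le>o |F|"
    using card_of_Field_ordIso[OF chat(1)] ordIso_ordLeq_trans by blast
  then obtain G where G: "G \<subseteq> F" "|Field (chat X)| =o |G|"
    using internalize_card_of_ordLeq2 by metis
  then have "|G| =o chat X"
    using card_of_Field_ordIso[OF chat(1)] ordIso_symmetric ordIso_transitive by metis
  moreover have "cellular_family X G"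
    using assms G(1) by (auto simp: cellular_family_def intro: pairwise_subset)
  ultimately show False
    using chat(2) by blast
qed

lemma chat_leI:
  assumes "Card_order \<kappa>" "\<And>F. cellular_family X F \<Longrightarrow> |F| <o \<kappa>"
  shows "chat X \<le>o \<kappa>"
  using chat(3)[of \<kappa> X] assms not_ordLess_ordIso by blast

lemma cellular_family_image:
  assumes "\<And>i. i \<in> I \<Longrightarrow> openin X (W i)" "\<And>i. i \<in> I \<Longrightarrow> W i \<noteq> {}"
    and "\<And>i j. i \<in> I \<Longrightarrow> j \<in> I \<Longrightarrow> i \<noteq> j \<Longrightarrow> disjnt (W i) (W j)"
  shows "|I| <o chat X"
proof -
  have "cellular_family X (W ` I)"
    using assms unfolding cellular_family_def pairwise_def by blast
  moreover have "inj_on W I"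
    using assms(2,3) by (metis disjnt_self_iff_empty inj_onI)
  ultimately show ?thesis
    using cellular_less_chat card_of_ordIsoI inj_on_imp_bij_betw ordIso_ordLess_trans by metis
qed

locale nonconstant_family =
  fixes X :: "'a topology" and g :: "'a set \<Rightarrow> 'a \<Rightarrow> real"
  assumes continuous: "openin X U \<Longrightarrow> U \<noteq> {} \<Longrightarrow> continuous_map X euclideanreal (g U)"
    and nonconstant: "openin X U \<Longrightarrow> U \<noteq> {} \<Longrightarrow> \<not> g U constant_on U"
begin

text \<open>One rule covers root, successors and limits: a node is cut out by nodes \<open>C\<close> above it
  together with the values \<open>y W\<close> that the functions \<open>g W\<close> take on it.\<close>

definition cell :: "'a set set \<Rightarrow> ('a set \<Rightarrow> real) \<Rightarrow> 'a set" where
  "cell C y = X interior_of {x \<in> topspace X. \<forall>W\<in>C. x \<in> W \<and> g W x = y W}"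

text \<open>\<open>C\<close> may be any set of nodes, which replaces a recursion over ordinals: the
  empty \<open>C\<close> yields the whole space, and non-emptiness discards contradictory
  conditions.\<close>

inductive_set nodes where
  cell: "(\<And>W. W \<in> C \<Longrightarrow> W \<in> nodes) \<Longrightarrow> cell C y \<noteq> {} \<Longrightarrow> cell C y \<in> nodes"

text \<open>Strict descent in the tree. Constancy of \<open>g V\<close> takes the place of
  properness of the inclusion: it makes the relation irreflexive on nodes and is inherited by
  subsets.\<close>

definition below :: "'a set \<Rightarrow> 'a set \<Rightarrow> bool" where
  "below U V \<longleftrightarrow> U \<subseteq> V \<and> g V constant_on U"

lemma cell_subset: "cell C y \<subseteq> {x \<in> topspace X. \<forall>W\<in>C. x \<in> W \<and> g W x = y W}"
  unfolding cell_def by (rule interior_of_subset)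

lemma subset_cell:
  assumes "openin X U" "\<And>x W. x \<in> U \<Longrightarrow> W \<in> C \<Longrightarrow> x \<in> W \<and> g W x = y W"
  shows "U \<subseteq> cell C y"
  unfolding cell_def using assms openin_subset by (intro interior_of_maximal) blast+

lemma openin_node: "U \<in> nodes \<Longrightarrow> openin X U"
  by (induction rule: nodes.induct) (simp add: cell_def)

lemma node_nonempty: "U \<in> nodes \<Longrightarrow> U \<noteq> {}"
  by (induction rule: nodes.induct) simp

lemma below_cell: "W \<in> C \<Longrightarrow> below (cell C y) W"
  using cell_subset[of C y] unfolding below_def constant_on_def by blast

lemma below_trans: "U \<subseteq> V \<Longrightarrow> below V W \<Longrightarrow> below U W"
  by (auto simp: below_def constant_on_def)

lemma not_below_self: "U \<in> nodes \<Longrightarrow> \<not> below U U"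
  using nonconstant openin_node node_nonempty unfolding below_def by blast

text \<open>If all conditions of the cell hold on \<open>V\<close>, then \<open>V\<close> is
  contained in it by maximality of the interior. Otherwise one violated condition \<open>W\<close>
  decides. The interesting case is \<open>below V W\<close>: then \<open>g W\<close> is constant on
  \<open>V\<close> with a value other than \<open>y W\<close>, so the cell misses
  \<open>V\<close>.\<close>

lemma cell_cases:
  assumes "openin X V" "\<And>W. W \<in> C \<Longrightarrow> W = V \<or> disjnt W V \<or> below W V \<or> below V W"
  shows "disjnt (cell C y) V \<or> below (cell C y) V \<or> V \<subseteq> cell C y"
proof (cases "\<forall>W\<in>C. below V W \<and> (\<forall>x\<in>V. g W x = y W)")
  case True
  then show ?thesis
    using subset_cell[OF assms(1)] unfolding below_def by blast
next
  case False
  then obtain W where W: "W \<in> C" "\<not> (below V W \<and> (\<forall>x\<in>V. g W x = y W))"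
    by blast
  have U: "below (cell C y) W" "\<And>x. x \<in> cell C y \<Longrightarrow> g W x = y W"
    using below_cell[OF W(1)] cell_subset[of C y] W(1) by blast+
  consider "W = V" | "disjnt W V" | "below W V" | "below V W"
    using assms(2) W(1) by blast
  then show ?thesis
  proof cases
    case 1
    then show ?thesis using U by blast
  next
    case 2
    then show ?thesis using U by (auto simp: below_def disjnt_def)
  next
    case 3
    then show ?thesis using U below_trans by (meson below_def)
  next
    case 4
    then obtain c where "c \<noteq> y W" "\<And>x. x \<in> V \<Longrightarrow> g W x = c"
      using W(2) unfolding below_def constant_on_def by metis
    then show ?thesis using U(2) by (auto simp: disjnt_def)
  qed
qed

text \<open>A double induction applies \<open>cell_cases\<close> in both directions: each of the two
  nodes is disjoint from the other, below it, or contains it, and mutual containment is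
  equality.\<close>

lemma node_cases:
  assumes "U \<in> nodes" "V \<in> nodes"
  shows "U = V \<or> disjnt U V \<or> below U V \<or> below V U"
  using assms
proof (induction U arbitrary: V rule: nodes.induct)
  case (cell C y)
  have U: "cell C y \<in> nodes"
    using cell.hyps by (rule nodes.cell)
  have outer: "disjnt (cell C y) V \<or> below (cell C y) V \<or> V \<subseteq> cell C y" if "V \<in> nodes" for V
    using cell.IH that by (intro cell_cases openin_node) blast+
  show ?case using cell.prems
  proof (induction V rule: nodes.induct)
    case (cell D z)
    have "cell D z \<in> nodes"
      using cell.hyps by (rule nodes.cell)
    moreover have "disjnt (cell D z) (cell C y) \<or> below (cell D z) (cell C y) \<or> cell C y \<subseteq> cell D z"
    proof (intro cell_cases openin_node U)
      fix W assume "W \<in> D"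
      then show "W = cell C y \<or> disjnt W (cell C y) \<or> below W (cell C y) \<or> below (cell C y) W"
        using cell.IH disjnt_sym by metis
    qed
    ultimately show ?case
      using outer by (auto simp: disjnt_sym)
  qed
qed

lemma node_subset_below:
  assumes "U \<in> nodes" "V \<in> nodes" "U \<subset> V"
  shows "below U V"
  using node_cases[OF assms(1,2)] assms node_nonempty[OF assms(1)]
  by (auto simp: below_def disjnt_def)

lemma node_comparable:
  assumes "U \<in> nodes" "V \<in> nodes" "\<not> disjnt U V"
  shows "U \<subseteq> V \<or> V \<subseteq> U"
  using node_cases[OF assms(1,2)] assms(3) by (auto simp: below_def)

text \<open>Well-foundedness under reverse inclusion. The cell \<open>N\<close> cut out by all nodes
  strictly above every member of \<open>S\<close>, with values read off at the common point
  \<open>p\<close>, contains each member. Since \<open>N\<close> is not below itself, it is not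
  among these nodes, so some member is not strictly below \<open>N\<close> and hence equals
  \<open>N\<close>.\<close>

lemma node_below_max:
  assumes "S \<subseteq> nodes" "S \<noteq> {}" "p \<in> topspace X" "\<And>W. W \<in> S \<Longrightarrow> p \<in> W"
  obtains M where "M \<in> S" "\<And>W. W \<in> S \<Longrightarrow> W \<subseteq> M"
proof -
  define C where "C = {V \<in> nodes. \<forall>W\<in>S. below W V}"
  define N where "N = cell C (\<lambda>V. g V p)"
  have "W \<subseteq> N" if "W \<in> S" for W
    unfolding N_def
  proof (rule subset_cell)
    show "openin X W" using that assms(1) openin_node by blast
    fix x V assume "x \<in> W" "V \<in> C"
    then have "below W V" using that by (auto simp: C_def)
    then show "x \<in> V \<and> g V x = g V p"
      using \<open>x \<in> W\<close> assms(4)[OF that] unfolding below_def constant_on_def by force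
  qed
  moreover from this have "N \<noteq> {}"
    using assms by blast
  then have N: "N \<in> nodes"
    unfolding N_def by (rule nodes.cell[rotated]) (simp add: C_def)
  have "N \<notin> C"
    using below_cell[of N C] not_below_self[OF N] N_def by blast
  then obtain W where W: "W \<in> S" "\<not> below W N"
    using N unfolding C_def by blast
  moreover have "W = N"
    using node_subset_below[OF _ N] W assms(1) calculation(1) by blast
  ultimately show ?thesis
    using that by blast
qed

text \<open>The process cannot get stuck: if every \<open>g V\<close> were constant on
  \<open>U\<close>, the cell \<open>N\<close> cut out by all nodes containing \<open>U\<close> would
  contain \<open>U\<close> as well. It would then be one of its own conditions, which makes
  \<open>g N\<close> constant on \<open>N\<close>.\<close>

lemma nodes_separate:
  assumes "openin X U" "U \<noteq> {}"
  shows "\<exists>V\<in>nodes. \<not> g V constant_on U"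
proof (rule ccontr)
  assume const: "\<not> (\<exists>V\<in>nodes. \<not> g V constant_on U)"
  obtain p where p: "p \<in> U" using assms(2) by blast
  define C where "C = {V \<in> nodes. U \<subseteq> V}"
  define N where "N = cell C (\<lambda>V. g V p)"
  have "U \<subseteq> N"
    unfolding N_def
  proof (rule subset_cell[OF assms(1)])
    fix x V assume "x \<in> U" "V \<in> C"
    then show "x \<in> V \<and> g V x = g V p"
      using const p unfolding C_def constant_on_def by force
  qed
  moreover have N: "N \<in> nodes"
    using \<open>U \<subseteq> N\<close> assms(2) unfolding N_def by (intro nodes.cell) (auto simp: C_def)
  ultimately have "below N N"
    using below_cell[of N C] by (simp add: C_def N_def)
  then show False
    using not_below_self[OF N] by blast
qed

lemma node_antichain_card:
  assumes "A \<subseteq> nodes" "\<And>U V. U \<in> A \<Longrightarrow> V \<in> A \<Longrightarrow> U \<subseteq> V \<Longrightarrow> U = V"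
  shows "|A| <o chat X"
proof (rule cellular_family_image[where W = "\<lambda>U. U"])
  show "disjnt U V" if "U \<in> A" "V \<in> A" "U \<noteq> V" for U V
    using that assms node_comparable by blast
qed (use assms(1) openin_node node_nonempty in blast)+

lemma node_chain_card:
  assumes "C \<subseteq> nodes" "\<And>U V. U \<in> C \<Longrightarrow> V \<in> C \<Longrightarrow> U \<subseteq> V \<or> V \<subseteq> U"
  shows "|C| <o chat X"
proof -
  \<comment> \<open>The common value of \<open>g U\<close> on the members strictly inside
    \<open>U\<close>: two such members are nested, so their values agree. If there are none, any
    number serves, as \<open>g U\<close> still takes another value on \<open>U\<close>.\<close>
  have "\<exists>c. \<forall>V\<in>C. V \<subset> U \<longrightarrow> (\<forall>x\<in>V. g U x = c)" if U: "U \<in> C" for U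
  proof (cases "\<exists>V\<in>C. V \<subset> U")
    case True
    then obtain V p where V: "V \<in> C" "V \<subset> U" "p \<in> V"
      using assms(1) node_nonempty by blast
    have "g U x = g U p" if W: "W \<in> C" "W \<subset> U" "x \<in> W" for W x
    proof -
      have "below W U" "below V U"
        using node_subset_below assms(1) U V W by blast+
      moreover have "x \<in> V \<or> p \<in> W"
        using assms(2) V W by blast
      ultimately show ?thesis
        using V W unfolding below_def constant_on_def by metis
    qed
    then show ?thesis by blast
  qed blast
  then obtain c where c: "\<And>U V x. U \<in> C \<Longrightarrow> V \<in> C \<Longrightarrow> V \<subset> U \<Longrightarrow> x \<in> V \<Longrightarrow> g U x = c U"
    by metis
  define W where "W U = {x \<in> topspace X. g U x \<in> - {c U}} \<inter> U" for U
  show ?thesis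
  proof (rule cellular_family_image[where W = W])
    fix U assume U: "U \<in> C"
    then have U': "openin X U" "U \<noteq> {}"
      using assms(1) openin_node node_nonempty by blast+
    have "openin X {x \<in> topspace X. g U x \<in> - {c U}}"
      using continuous[OF U'] by (rule openin_continuous_map_preimage) auto
    then show "openin X (W U)"
      using U' by (auto simp: W_def)
    show "W U \<noteq> {}"
      using nonconstant[OF U'] openin_subset[OF U'(1)] unfolding W_def constant_on_def by blast
    fix V assume V: "V \<in> C" "U \<noteq> V"
    show "disjnt (W U) (W V)"
      using assms(2)[OF U V(1)]
    proof
      assume "U \<subseteq> V"
      then show ?thesis
        using c[OF V(1) U] V(2) by (auto simp: W_def disjnt_def)
    next
      assume "V \<subseteq> U"
      then show ?thesis
        using c[OF U V(1)] V(2) by (auto simp: W_def disjnt_def)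
    qed
  qed
qed

end

section \<open>Trees with small chains and antichains\<close>

lemma tree_below:
  assumes "is_tree r" "t \<in> Field r"
  shows "well_order_on (underS r t) (Restr r (underS r t))"
    and "Well_order (Restr r (underS r t))" "Field (Restr r (underS r t)) = underS r t"
proof -
  show *: "well_order_on (underS r t) (Restr r (underS r t))"
    using assms by (auto simp: is_tree_def)
  show "Well_order (Restr r (underS r t))" "Field (Restr r (underS r t)) = underS r t"
    using well_order_on_Well_order[OF *] by auto
qed

lemma Restr_underS_underS:
  assumes "trans r" "antisym r" "s \<in> underS r t"
  shows "Restr (Restr r (underS r t)) (underS (Restr r (underS r t)) s) = Restr r (underS r s)"
proof -
  have "underS r s \<subseteq> underS r t"
    using assms unfolding underS_def trans_def antisym_def by blast
  moreover from this have "underS (Restr r (underS r t)) s = underS r s"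
    using assms(3) unfolding underS_def by blast
  ultimately show ?thesis by auto
qed

lemma tree_below_Restr:
  assumes "is_tree r" "s \<in> underS r t"
  shows "Restr (Restr r (underS r t)) (underS (Restr r (underS r t)) s) = Restr r (underS r s)"
  using assms by (intro Restr_underS_underS) (auto simp: is_tree_def order_on_defs)

lemma tree_below_ordLess:
  assumes "is_tree r" "s \<in> underS r t"
  shows "Restr r (underS r s) <o Restr r (underS r t)"
proof -
  have t: "t \<in> Field r" using assms(2) by (auto simp: underS_def Field_def)
  show ?thesis
    using underS_Restr_ordLess[OF tree_below(2)[OF assms(1) t], of s]
    unfolding tree_below_Restr[OF assms] tree_below(3)[OF assms(1) t] using assms(2) by blast
qed

lemma tree_below_level:
  assumes "is_tree r" "t \<in> Field r" "\<beta> <o Restr r (underS r t)"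
  obtains s where "s \<in> tree_level r \<beta>"
proof -
  have "Well_order \<beta>" using assms(3) by (simp add: ordLess_def)
  then obtain s where s: "s \<in> underS r t"
      "\<beta> =o Restr (Restr r (underS r t)) (underS (Restr r (underS r t)) s)"
    using ordLess_iff_ordIso_Restr[OF tree_below(2)[OF assms(1,2)]] assms(3)
      tree_below(3)[OF assms(1,2)] by auto
  then have "Restr r (underS r s) =o \<beta>"
    using tree_below_Restr[OF assms(1) s(1)] ordIso_symmetric by metis
  then show ?thesis
    using that s(1) by (auto simp: tree_level_def underS_def Field_def)
qed

lemma antichain_tree_level:
  assumes "is_tree r"
  shows "antichain_in r (tree_level r \<beta>)"
  unfolding antichain_in_def
proof (intro conjI ballI impI)
  fix s t assume st: "s \<in> tree_level r \<beta>" "t \<in> tree_level r \<beta>" "s \<noteq> t"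
  show "(s, t) \<notin> r"
  proof
    assume "(s, t) \<in> r"
    then have "Restr r (underS r s) <o Restr r (underS r t)"
      using tree_below_ordLess[OF assms] st(3) by (auto simp: underS_def)
    moreover have "Restr r (underS r s) =o Restr r (underS r t)"
      using st ordIso_transitive ordIso_symmetric unfolding tree_level_def by blast
    ultimately show False
      using not_ordLess_ordIso by blast
  qed
qed (auto simp: tree_level_def)

lemma tree_below_Chains:
  assumes "is_tree r" "t \<in> Field r"
  shows "underS r t \<in> Chains r"
proof -
  have "total_on (underS r t) (Restr r (underS r t))" "refl_on (underS r t) (Restr r (underS r t))"
    using tree_below(1)[OF assms]
    by (auto simp: well_order_on_def linear_order_on_def partial_order_on_def preorder_on_def)
  then have "(a, b) \<in> r \<or> (b, a) \<in> r" if "a \<in> underS r t" "b \<in> underS r t" for a b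
    using that by (cases "a = b") (auto simp: total_on_def refl_on_def)
  then show ?thesis
    by (simp add: Chains_def)
qed

lemma Well_order_ordLess_Card_order:
  assumes "Card_order \<kappa>" "Well_order w" "|Field w| <o \<kappa>"
  shows "w <o \<kappa>"
proof (rule ccontr)
  assume "\<not> w <o \<kappa>"
  then have "\<kappa> \<le>o w"
    using assms(1,2) not_ordLess_iff_ordLeq by (metis card_order_on_def)
  then have "\<kappa> \<le>o |Field w|"
    using card_of_mono2 card_of_Field_ordIso[OF assms(1)] ordIso_symmetric ordIso_ordLeq_trans by metis
  then show False
    using assms(3) not_ordLess_ordLeq by blast
qed

lemma tree_below_ordLess_Card_order:
  assumes "is_tree r" "t \<in> Field r" "Card_order \<kappa>" "\<forall>C\<in>Chains r. |C| <o \<kappa>"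
  shows "Restr r (underS r t) <o \<kappa>"
  using Well_order_ordLess_Card_order[OF assms(3) tree_below(2)[OF assms(1,2)]]
    tree_below_Chains[OF assms(1,2)] assms(4) tree_below(3)[OF assms(1,2)] by metis

text \<open>Every ordinal below \<kappa> is isomorphic to a proper initial segment of \<kappa>, so
  the elements of \<kappa> index the levels.\<close>

lemma Field_tree_subset:
  assumes "is_tree r" "Well_order \<kappa>" "\<And>t. t \<in> Field r \<Longrightarrow> Restr r (underS r t) <o \<kappa>"
  shows "Field r = (\<Union>a\<in>Field \<kappa>. tree_level r (Restr \<kappa> (underS \<kappa> a)))"
proof
  show "Field r \<subseteq> (\<Union>a\<in>Field \<kappa>. tree_level r (Restr \<kappa> (underS \<kappa> a)))"
  proof
    fix t assume t: "t \<in> Field r"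
    then obtain a where "a \<in> Field \<kappa>" "Restr r (underS r t) =o Restr \<kappa> (underS \<kappa> a)"
      using ordLess_iff_ordIso_Restr[OF assms(2) tree_below(2)[OF assms(1) t]] assms(3)[OF t]
      by blast
    then show "t \<in> (\<Union>a\<in>Field \<kappa>. tree_level r (Restr \<kappa> (underS \<kappa> a)))"
      using t by (auto simp: tree_level_def)
  qed
qed (auto simp: tree_level_def)

text \<open>The bound on chains leaves at most \<kappa> levels, and each level is an
  antichain.\<close>

lemma card_tree_le:
  assumes "is_tree r" "Cinfinite \<kappa>" "\<forall>C\<in>Chains r. |C| <o \<kappa>" "\<And>A. antichain_in r A \<Longrightarrow> |A| <o \<kappa>"
  shows "|Field r| \<le>o \<kappa>"
proof -
  have *: "Field r = (\<Union>a\<in>Field \<kappa>. tree_level r (Restr \<kappa> (underS \<kappa> a)))"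
    using assms by (intro Field_tree_subset tree_below_ordLess_Card_order) (auto simp: card_order_on_def)
  have "|Field \<kappa>| \<le>o \<kappa>"
    using assms(2) card_of_Field_ordIso ordIso_imp_ordLeq by blast
  then show ?thesis
    unfolding * using assms antichain_tree_level[OF assms(1)]
    by (intro UNION_Cinfinite_bound) (auto intro: ordLess_imp_ordLeq)
qed

text \<open>The predecessors of a node form a small chain, so level \<kappa> is empty. If a level
  below \<kappa> were empty, no node could lie above it, and the whole tree would be a union of
  fewer than \<kappa> small levels, against regularity.\<close>

lemma has_height_tree:
  assumes r: "is_tree r" and \<kappa>: "Cinfinite \<kappa>" "regularCard \<kappa>"
    and chains: "\<forall>C\<in>Chains r. |C| <o \<kappa>" and antichains: "\<And>A. antichain_in r A \<Longrightarrow> |A| <o \<kappa>"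
    and large: "\<not> |Field r| <o \<kappa>"
  shows "has_height r \<kappa>"
  unfolding has_height_def
proof (intro conjI allI impI)
  show wo: "Well_order \<kappa>" using \<kappa> by (auto simp: card_order_on_def)
  show "tree_level r \<kappa> = {}"
    using tree_below_ordLess_Card_order[OF r _ _ chains] \<kappa> not_ordLess_ordIso
    by (fastforce simp: tree_level_def)
  fix \<beta> :: "'b rel" assume \<beta>: "\<beta> <o \<kappa>"
  then have wo\<beta>: "Well_order \<beta>" by (simp add: ordLess_def)
  show "tree_level r \<beta> \<noteq> {}"
  proof
    assume empty: "tree_level r \<beta> = {}"
    have "Restr r (underS r t) <o \<beta>" if t: "t \<in> Field r" for t
    proof (rule ccontr)
      assume "\<not> Restr r (underS r t) <o \<beta>"
      then have "\<beta> \<le>o Restr r (underS r t)"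
        using wo\<beta> tree_below(2)[OF r t] not_ordLess_iff_ordLeq by blast
      then consider "\<beta> <o Restr r (underS r t)" | "Restr r (underS r t) =o \<beta>"
        using ordLeq_iff_ordLess_or_ordIso ordIso_symmetric by blast
      then show False
      proof cases
        case 1
        then show False
          using tree_below_level[OF r t] empty by (metis empty_iff)
      next
        case 2
        then show False
          using empty t unfolding tree_level_def by blast
      qed
    qed
    then have eq: "Field r = (\<Union>a\<in>Field \<beta>. tree_level r (Restr \<beta> (underS \<beta> a)))"
      by (rule Field_tree_subset[OF r wo\<beta>])
    have "|Field \<beta>| <o \<kappa>"
      using \<beta> card_of_least[of "Field \<beta>" \<beta>] wo\<beta> ordLeq_ordLess_trans by blast
    then have "|Field r| <o \<kappa>"
      unfolding eq using \<kappa> antichains antichain_tree_level[OF r]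
      by (intro stable_UNION regularCard_stable) (auto simp: cinfinite_def)
    then show False using large by blast
  qed
qed

text \<open>Pick one node on each of the \<kappa> levels; distinct proper initial segments of a
  well-order are not isomorphic, so the choice is injective.\<close>

lemma card_Suslin_tree:
  assumes "Card_order \<kappa>" "Suslin_tree \<kappa> r"
  shows "\<kappa> \<le>o |Field r|"
proof -
  have wo: "Well_order \<kappa>" using assms(1) by (simp add: card_order_on_def)
  have "\<exists>t. t \<in> tree_level r (Restr \<kappa> (underS \<kappa> a))" if "a \<in> Field \<kappa>" for a
    using assms(2) underS_Restr_ordLess[OF wo] that
    unfolding Suslin_tree_def has_height_def by (metis empty_iff ex_in_conv)
  then obtain f where f: "\<And>a. a \<in> Field \<kappa> \<Longrightarrow> f a \<in> tree_level r (Restr \<kappa> (underS \<kappa> a))"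
    by metis
  have "inj_on f (Field \<kappa>)"
  proof (rule inj_onI, rule ccontr)
    fix a b assume ab: "a \<in> Field \<kappa>" "b \<in> Field \<kappa>" "f a = f b" "a \<noteq> b"
    have iso: "Restr \<kappa> (underS \<kappa> a) =o Restr \<kappa> (underS \<kappa> b)"
      using f[OF ab(1)] f[OF ab(2)] ab(3) ordIso_symmetric ordIso_transitive
      unfolding tree_level_def by fastforce
    have less: "Restr \<kappa> (underS \<kappa> x) <o Restr \<kappa> (underS \<kappa> y)" if "(x, y) \<in> \<kappa>" "x \<noteq> y" for x y
    proof -
      have "Restr (Restr \<kappa> (underS \<kappa> y)) (underS (Restr \<kappa> (underS \<kappa> y)) x) = Restr \<kappa> (underS \<kappa> x)"
        using that wo by (intro Restr_underS_underS) (auto simp: underS_def order_on_defs)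
      moreover have "Well_order (Restr \<kappa> (underS \<kappa> y))"
        using wo Well_order_Restr by blast
      moreover have "x \<in> Field (Restr \<kappa> (underS \<kappa> y))"
        using that wo by (auto simp: underS_def order_on_defs refl_on_def Field_def)
      ultimately show ?thesis
        using underS_Restr_ordLess by (metis empty_iff)
    qed
    have "(a, b) \<in> \<kappa> \<or> (b, a) \<in> \<kappa>"
      using wo ab by (auto simp: order_on_defs total_on_def)
    then show False
      using less ab(4) iso not_ordLess_ordIso ordIso_symmetric by metis
  qed
  moreover have "f ` Field \<kappa> \<subseteq> Field r"
    using f by (auto simp: tree_level_def)
  ultimately have "|Field \<kappa>| \<le>o |Field r|"
    using card_of_ordLeq by blast
  then show ?thesis
    using card_of_Field_ordIso[OF assms(1)] ordIso_symmetric ordIso_ordLeq_trans by blast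
qed

section \<open>Images under families of real functions\<close>

lemma card_Fpow_le:
  assumes "Cinfinite \<kappa>" "|A| \<le>o \<kappa>"
  shows "|Fpow A| \<le>o \<kappa>"
proof -
  have inf: "\<not> finite (Field \<kappa>)" "Card_order \<kappa>"
    using assms(1) by (auto simp: cinfinite_def)
  have single: "|{x}| \<le>o \<kappa>" for x :: 'c
    using inf Card_order_singl_ordLeq by (metis finite.emptyI)
  have *: "|{X. X \<subseteq> A \<and> finite X \<and> card X \<le> n}| \<le>o \<kappa>" for n
  proof (induction n)
    case 0
    have "{X. X \<subseteq> A \<and> finite X \<and> card X \<le> 0} = {{}}" by auto
    then show ?case using single by simp
  next
    case (Suc n)
    let ?F = "{X. X \<subseteq> A \<and> finite X \<and> card X \<le> n}"
    let ?I = "(\<lambda>(a, X). insert a X) ` (A \<times> ?F)"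
    have "{X. X \<subseteq> A \<and> finite X \<and> card X \<le> Suc n} \<subseteq> ?F \<union> ?I"
    proof
      fix X assume X: "X \<in> {X. X \<subseteq> A \<and> finite X \<and> card X \<le> Suc n}"
      show "X \<in> ?F \<union> ?I"
      proof (cases "X = {}")
        case False
        then obtain a where "a \<in> X" by blast
        then have "(a, X - {a}) \<in> A \<times> ?F" "insert a (X - {a}) = X"
          using X by (auto simp: card_Diff_singleton)
        then show ?thesis by (intro UnI2) (metis (no_types, lifting) case_prod_conv rev_image_eqI)
      qed auto
    qed
    moreover have "|?I| \<le>o \<kappa>"
      by (rule ordLeq_transitive[OF card_of_image
            card_of_Times_ordLeq_infinite_Field[OF inf(1) assms(2) Suc inf(2)]])
    then have "|?F \<union> ?I| \<le>o \<kappa>"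
      by (rule card_of_Un_ordLeq_infinite_Field[OF inf(1) Suc _ inf(2)])
    ultimately show ?case
      by (rule ordLeq_transitive[OF card_of_mono1])
  qed
  have eq: "Fpow A = (\<Union>n. {X. X \<subseteq> A \<and> finite X \<and> card X \<le> n})"
    by (auto simp: Fpow_def)
  have "|UNIV :: nat set| \<le>o \<kappa>"
    by (rule ordIso_ordLeq_trans[OF card_of_nat natLeq_ordLeq_cinfinite[OF assms(1)]])
  then show ?thesis
    unfolding eq using * assms(1) by (intro UNION_Cinfinite_bound) blast+
qed

section \<open>Weight and complete regularity of generated topologies\<close>

text \<open>The empty family is left out because its intersection is \<open>UNIV\<close>, which need
  not be open.\<close>

lemma generate_topology_basis:
  assumes "generate_topology_on S U" "x \<in> U"
  shows "\<exists>F\<in>Fpow S - {{}}. x \<in> \<Inter>F \<and> \<Inter>F \<subseteq> U"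
  using assms
proof (induction arbitrary: x rule: generate_topology_on.induct)
  case (Int a b)
  then obtain F G where "F \<in> Fpow S - {{}}" "x \<in> \<Inter>F \<and> \<Inter>F \<subseteq> a"
      and "G \<in> Fpow S - {{}}" "x \<in> \<Inter>G \<and> \<Inter>G \<subseteq> b"
    by (meson IntE)
  then show ?case
    by (intro bexI[of _ "F \<union> G"]) (auto simp: Fpow_def)
next
  case (Basis s)
  then show ?case
    by (intro bexI[of _ "{s}"]) (auto simp: Fpow_def)
next
  case (UN K)
  then show ?case
    by (meson Sup_upper UnionE order_trans)
qed simp

lemma weight_generated_le:
  assumes "Cinfinite \<kappa>" "|S| \<le>o \<kappa>"
  shows "weight (topology_generated_by S) \<le>o \<kappa>"
proof -
  have "base_of (topology_generated_by S) (Inter ` (Fpow S - {{}}))"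
    unfolding base_of_def
  proof (intro conjI allI impI ballI)
    fix V assume "V \<in> Inter ` (Fpow S - {{}})"
    then show "openin (topology_generated_by S) V"
      unfolding openin_topology_generated_by_iff Fpow_def
      by (auto intro!: generate_topology_on_Inter intro: generate_topology_on.Basis)
  next
    fix U x assume "openin (topology_generated_by S) U \<and> x \<in> U"
    then show "\<exists>V\<in>Inter ` (Fpow S - {{}}). x \<in> V \<and> V \<subseteq> U"
      using generate_topology_basis[of S U x]
      unfolding openin_topology_generated_by_iff by blast
  qed
  from weight(3)[OF this] show ?thesis
    by (rule ordLeq_transitive[OF _ ordLeq_transitive[OF card_of_image
          ordLeq_transitive[OF card_of_mono1[OF Diff_subset] card_Fpow_le[OF assms]]]])
qed

text \<open>A test on a subbase. Inequalities in place of the exact values 0 and 1 let the maximum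
  of two functions serve an intersection; clipping to the unit interval at the end restores the
  exact values.\<close>

lemma completely_regular_generated:
  assumes "\<And>s x. s \<in> S \<Longrightarrow> x \<in> s \<Longrightarrow>
    \<exists>f. continuous_map (topology_generated_by S) euclideanreal f \<and> f x \<le> 0 \<and> (\<forall>y\<in>\<Union>S - s. 1 \<le> f y)"
  shows "completely_regular_space (topology_generated_by S)"
proof -
  let ?sep = "\<lambda>x U. \<exists>f. continuous_map (topology_generated_by S) euclideanreal f \<and>
    f x \<le> 0 \<and> (\<forall>y\<in>\<Union>S - U. 1 \<le> f y)"
  have "?sep x U" if "generate_topology_on S U" "x \<in> U" for x U
    using that
  proof (induction arbitrary: x rule: generate_topology_on.induct)
    case (Int a b)
    then have "x \<in> a" "x \<in> b" by auto
    obtain f where f: "continuous_map (topology_generated_by S) euclideanreal f"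
        "f x \<le> 0" "\<forall>y\<in>\<Union>S - a. 1 \<le> f y"
      using Int.IH(1)[OF \<open>x \<in> a\<close>] by (elim exE conjE) (rule that)
    obtain h where h: "continuous_map (topology_generated_by S) euclideanreal h"
        "h x \<le> 0" "\<forall>y\<in>\<Union>S - b. 1 \<le> h y"
      using Int.IH(2)[OF \<open>x \<in> b\<close>] by (elim exE conjE) (rule that)
    show ?case
    proof (intro exI conjI ballI)
      show "continuous_map (topology_generated_by S) euclideanreal (\<lambda>x. max (f x) (h x))"
        using f(1) h(1) by (rule continuous_map_real_max)
    qed (use f h in \<open>auto simp: le_max_iff_disj\<close>)
  next
    case (UN K)
    then obtain k where k: "k \<in> K" "x \<in> k" by blast
    obtain f where f: "continuous_map (topology_generated_by S) euclideanreal f"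
        "f x \<le> 0" "\<forall>y\<in>\<Union>S - k. 1 \<le> f y"
      using UN.IH[OF k] by (elim exE conjE) (rule that)
    show ?case
      by (intro exI[of _ f] conjI ballI f) (use f(3) k(1) in blast)
  next
    case (Basis s)
    then show ?case by (rule assms)
  qed simp
  then have sep: "?sep x U" if "openin (topology_generated_by S) U" "x \<in> U" for x U
    using that by (simp add: openin_topology_generated_by_iff)
  show ?thesis
    unfolding completely_regular_space_alt'
  proof (intro allI impI)
    fix U x assume "openin (topology_generated_by S) U" "x \<in> U"
    from sep[OF this] obtain f where f: "continuous_map (topology_generated_by S) euclideanreal f"
      "f x \<le> 0" "\<forall>y\<in>\<Union>S - U. 1 \<le> f y"
      by (elim exE conjE) (rule that)
    have "continuous_map (topology_generated_by S) euclideanreal (\<lambda>y. max 0 (min 1 (f y)))"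
      using f(1) by (intro continuous_map_real_max continuous_map_real_min) auto
    moreover have "max 0 (min 1 (f x)) = 0"
      using f(2) by auto
    moreover have "max 0 (min 1 (f y)) = 1" if "y \<in> \<Union>S - U" for y
      using bspec[OF f(3) that] by simp
    ultimately show "\<exists>f. continuous_map (topology_generated_by S) euclideanreal f \<and> f x = 0 \<and>
        f ` (topspace (topology_generated_by S) - U) \<subseteq> {1}"
      by (intro exI[of _ "\<lambda>y. max 0 (min 1 (f y))"] conjI) (auto simp del: Union_iff)
  qed
qed

text \<open>\<open>Y\<close> carries the initial topology of the functions in \<open>G\<close>. Each
  of them factors through \<open>p\<close>, so \<open>p\<close> cannot be constant where one of them
  varies.\<close>

lemma evaluation_image:
  fixes X :: "'a topology" and G :: "('a \<Rightarrow> real) set"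
  assumes cont: "\<And>h. h \<in> G \<Longrightarrow> continuous_map X euclideanreal h"
    and nonconst: "\<And>U. openin X U \<Longrightarrow> U \<noteq> {} \<Longrightarrow> \<exists>h\<in>G. \<not> h constant_on U"
  obtains Y :: "'a topology"
  where "crowded Y" "tychonov Y" "nowhere_constant_image X Y" "weight Y \<le>o |G <+> (UNIV :: nat set)|"
proof -
  \<comment> \<open>The image is realised on representatives of the fibres, so that it lives on the type of \<open>X\<close>.\<close>
  define p where "p x = (SOME y. y \<in> topspace X \<and> (\<forall>h\<in>G. h y = h x))" for x
  have p: "p x \<in> topspace X" "\<And>h. h \<in> G \<Longrightarrow> h (p x) = h x" if "x \<in> topspace X" for x
    using someI[of "\<lambda>y. y \<in> topspace X \<and> (\<forall>h\<in>G. h y = h x)" x] that by (auto simp: p_def)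
  have p_eq: "p x = p y" if "\<And>h. h \<in> G \<Longrightarrow> h x = h y" for x y
  proof -
    have "(\<lambda>z. \<forall>h\<in>G. h z = h x) = (\<lambda>z. \<forall>h\<in>G. h z = h y)"
      by (intro ext) (metis that)
    then show ?thesis
      unfolding p_def by metis
  qed
  define P where "P = p ` topspace X"
  \<comment> \<open>Rational thresholds suffice to generate the topology and keep the number of
    generators at \<open>|G|\<close> times a countable set; the flag \<open>b\<close> selects the
    upper or the lower ray.\<close>
  define R where "R = (\<lambda>(h :: 'a \<Rightarrow> real, q :: rat, b). {x \<in> P. if b then of_rat q < h x else h x < of_rat q})"
  define S where "S = insert P (R ` (G \<times> UNIV \<times> UNIV))"
  define Y where "Y = topology_generated_by S"
  have P: "\<Union>S = P" "topspace Y = P"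
    by (auto simp: S_def R_def Y_def)
  have open_R: "openin Y (R (h, q, b))" if "h \<in> G" for h q b
    unfolding Y_def using that by (intro topology_generated_by_Basis) (auto simp: S_def)
  have cont_Y: "continuous_map Y euclideanreal h" if h: "h \<in> G" for h
    unfolding continuous_map_upper_lower_semicontinuous_lt P
  proof (intro allI conjI)
    fix a
    have "{x \<in> P. a < h x} = (\<Union>q\<in>{q. a < of_rat q}. R (h, q, True))"
      using of_rat_dense by (fastforce simp: R_def)
    then show "openin Y {x \<in> P. a < h x}"
      using open_R[OF h] by auto
    have "{x \<in> P. h x < a} = (\<Union>q\<in>{q. of_rat q < a}. R (h, q, False))"
      using of_rat_dense by (fastforce simp: R_def)
    then show "openin Y {x \<in> P. h x < a}"
      using open_R[OF h] by auto
  qed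
  have "completely_regular_space Y"
    unfolding Y_def
  proof (rule completely_regular_generated)
    fix s x assume s: "s \<in> S" "x \<in> s"
    then consider "s = P" | h q b where "h \<in> G" "s = R (h, q, b)"
      by (auto simp: S_def)
    then show "\<exists>f. continuous_map (topology_generated_by S) euclideanreal f \<and> f x \<le> 0 \<and>
        (\<forall>y\<in>\<Union>S - s. 1 \<le> f y)"
    proof cases
      case 1
      then show ?thesis
        unfolding P by (intro exI[of _ "\<lambda>_. 0"]) auto
    next
      case (2 h q b)
      \<comment> \<open>The signed distance to the threshold treats both kinds of rays at once: the
        quotient below vanishes at \<open>x\<close> and is at least 1 wherever \<open>h\<close> lies
        on the other side of \<open>q\<close>.\<close>
      define d where "d = h x - of_rat q"
      have "d \<noteq> 0" using 2 s(2) by (auto simp: d_def R_def split: if_splits)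
      then have "continuous_map Y euclideanreal (\<lambda>y. (h x - h y) / d)"
        using cont_Y[OF 2(1)]
        by (intro continuous_map_real_divide continuous_map_diff) auto
      moreover have "1 \<le> (h x - h y) / d" if "y \<in> P - s" for y
        using 2 s(2) that by (auto simp: R_def d_def divide_simps split: if_splits)
      ultimately show ?thesis
        unfolding P Y_def[symmetric] by (intro exI[of _ "\<lambda>y. (h x - h y) / d"]) auto
    qed
  qed
  moreover have "Hausdorff_space Y"
    unfolding Hausdorff_space_def P
  proof (intro allI impI)
    fix x y assume xy: "x \<in> P \<and> y \<in> P \<and> x \<noteq> y"
    then obtain u v where uv: "u \<in> topspace X" "v \<in> topspace X" "x = p u" "y = p v"
      by (auto simp: P_def)
    then obtain h where h: "h \<in> G" "h x \<noteq> h y"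
      using p_eq[of u v] xy p(2) by metis
    obtain q where q: "h x < of_rat q \<and> of_rat q < h y \<or> h y < of_rat q \<and> of_rat q < h x"
      using of_rat_dense h(2) by (metis linorder_neqE)
    show "\<exists>U V. openin Y U \<and> openin Y V \<and> x \<in> U \<and> y \<in> V \<and> disjnt U V"
      by (rule exI[of _ "R (h, q, h y < h x)"], rule exI[of _ "R (h, q, h x < h y)"])
        (use q xy open_R[OF h(1)] in \<open>auto simp: R_def disjnt_def\<close>)
  qed
  ultimately have "tychonov Y"
    by (simp add: tychonov_def)
  have "continuous_map X Y p"
    unfolding Y_def
  proof (rule continuous_on_generated_topo)
    show "p ` topspace X \<subseteq> \<Union>S"
      unfolding P P_def by simp
    fix s assume "s \<in> S"
    then consider "s = P" | h q b where "h \<in> G" "s = R (h, q, b)"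
      by (auto simp: S_def)
    then show "openin X (p -` s \<inter> topspace X)"
    proof cases
      case 1
      then have "p -` s \<inter> topspace X = topspace X" by (auto simp: P_def)
      then show ?thesis by simp
    next
      case (2 h q b)
      have "h (p x) = h x" "p x \<in> P" if "x \<in> topspace X" for x
        using p(2)[OF that 2(1)] that by (auto simp: P_def)
      then have "p -` s \<inter> topspace X =
          (if b then {x \<in> topspace X. of_rat q < h x} else {x \<in> topspace X. h x < of_rat q})"
        unfolding 2(2) by (auto simp: R_def)
      then show ?thesis
        using cont[OF 2(1)] unfolding continuous_map_upper_lower_semicontinuous_lt by simp
    qed
  qed
  moreover have nonconst_p: "\<not> p constant_on U" if U: "openin X U" "U \<noteq> {}" for U
  proof -
    obtain h where h: "h \<in> G" "\<not> h constant_on U"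
      using nonconst U by blast
    have "h x = h (p x)" if "x \<in> U" for x
      using p(2)[OF _ h(1)] openin_subset[OF U(1)] that by fastforce
    then show ?thesis
      using h(2) unfolding constant_on_def by metis
  qed
  ultimately have image: "nowhere_constant_image X Y"
    unfolding nowhere_constant_image_def nowhere_constant_def
    by (intro exI[of _ p]) (simp add: P P_def)
  \<comment> \<open>An isolated point of \<open>Y\<close> would have a non-empty open fibre, on
    which \<open>p\<close> is constant.\<close>
  have "crowded Y"
    unfolding crowded_def
  proof (intro ballI notI)
    fix y assume y: "y \<in> topspace Y" "openin Y {y}"
    have "openin X {x \<in> topspace X. p x \<in> {y}}"
      using \<open>continuous_map X Y p\<close> y(2) by (rule openin_continuous_map_preimage)
    moreover have "{x \<in> topspace X. p x \<in> {y}} \<noteq> {}"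
      using y(1) unfolding P by (auto simp: P_def)
    moreover have "p constant_on {x \<in> topspace X. p x \<in> {y}}"
      by (auto simp: constant_on_def)
    ultimately show False using nonconst_p by blast
  qed
  have inf: "Cinfinite |G <+> (UNIV :: nat set)|"
    by (auto simp: cinfinite_def Field_card_of card_of_card_order_on)
  have rat: "|UNIV :: (rat \<times> bool) set| \<le>o |G <+> (UNIV :: nat set)|"
    by (rule ordLeq_transitive[OF card_of_ordLeqI[of to_nat] card_of_Plus2]) auto
  have "|G \<times> (UNIV :: (rat \<times> bool) set)| \<le>o |G <+> (UNIV :: nat set)|"
    using inf rat card_of_Plus1 by (intro card_of_Times_ordLeq_infinite_Field) (auto simp: cinfinite_def)
  then have "|R ` (G \<times> UNIV \<times> UNIV)| \<le>o |G <+> (UNIV :: nat set)|"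
    unfolding UNIV_Times_UNIV by (rule ordLeq_transitive[OF card_of_image])
  moreover have "|{P}| \<le>o |G <+> (UNIV :: nat set)|"
    by (rule card_of_singl_ordLeq) simp
  ultimately have "|{P} \<union> R ` (G \<times> UNIV \<times> UNIV)| \<le>o |G <+> (UNIV :: nat set)|"
    using inf by (intro Un_Cinfinite_bound)
  then have "weight Y \<le>o |G <+> (UNIV :: nat set)|"
    unfolding Y_def S_def using inf by (intro weight_generated_le) auto
  then show ?thesis
    using that \<open>crowded Y\<close> \<open>tychonov Y\<close> image by blast
qed

section \<open>Nonconstant functions and cellular families in crowded spaces\<close>

lemma crowded_point:
  assumes "crowded X" "openin X U" "x \<in> U"
  obtains y where "y \<in> U" "y \<noteq> x"
proof -
  have "U \<noteq> {x}"
    using assms openin_subset unfolding crowded_def by blast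
  then show ?thesis
    using assms(3) that by blast
qed

lemma nonconstant_function:
  assumes "crowded X" "tychonov X" "openin X U" "U \<noteq> {}"
  obtains f where "continuous_map X euclideanreal f" "\<not> f constant_on U"
proof -
  obtain x where x: "x \<in> U" using assms(4) by blast
  obtain y where y: "y \<in> U" "y \<noteq> x"
    using crowded_point[OF assms(1,3) x] .
  have "closedin X {y}" "x \<in> topspace X - {y}"
    using assms(2,3) x y openin_subset unfolding tychonov_def
    by (auto intro: closedin_Hausdorff_singleton)
  then obtain f where f: "continuous_map X euclideanreal f \<and> f x = 0 \<and> f ` {y} \<subseteq> {1}"
    using assms(2) unfolding tychonov_def completely_regular_space_alt by metis
  then have "f x \<noteq> f y" by simp
  then have "\<not> f constant_on U"
    using x y(1) unfolding constant_on_def by metis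
  then show ?thesis
    using that f by blast
qed

lemma ex_nonconstant_family:
  assumes "crowded X" "tychonov X"
  obtains g where "nonconstant_family X g"
proof -
  have "\<exists>f. continuous_map X euclideanreal f \<and> \<not> f constant_on U" if "openin X U" "U \<noteq> {}" for U
    using nonconstant_function[OF assms that] by metis
  then obtain g where "\<And>U. openin X U \<Longrightarrow> U \<noteq> {} \<Longrightarrow>
      continuous_map X euclideanreal (g U) \<and> \<not> g U constant_on U"
    by metis
  then show ?thesis
    using that[of g] by (simp add: nonconstant_family_def)
qed

text \<open>Repeatedly separating two points inside an open set produces cellular families of every
  finite size, so no finite cardinal is excluded.\<close>

lemma infinite_chat:
  assumes "crowded X" "Hausdorff_space X" "topspace X \<noteq> {}"
  shows "Cinfinite (chat X)"
proof -
  have split: "\<exists>F. cellular_family X F \<and> \<Union>F \<subseteq> U \<and> finite F \<and> card F = n"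
    if "openin X U" "U \<noteq> {}" for U n
    using that
  proof (induction n arbitrary: U)
    case 0
    then show ?case by (intro exI[of _ "{}"]) (auto simp: cellular_family_def)
  next
    case (Suc n)
    then obtain x where x: "x \<in> U" by blast
    obtain y where y: "y \<in> U" "y \<noteq> x"
      using crowded_point[OF assms(1) Suc.prems(1) x] .
    obtain V W where VW: "openin X V" "openin X W" "x \<in> V" "y \<in> W" "disjnt V W"
      using assms(2) x y openin_subset[OF Suc.prems(1)] unfolding Hausdorff_space_def by (metis subsetD)
    have "openin X (V \<inter> U)" "V \<inter> U \<noteq> {}" "openin X (W \<inter> U)" "W \<inter> U \<noteq> {}"
      using VW x y Suc.prems(1) by auto
    moreover from Suc.IH[OF this(1,2)]
    obtain F where F: "cellular_family X F" "\<Union>F \<subseteq> V \<inter> U" "finite F" "card F = n"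
      by blast
    ultimately show ?case
      using VW(5)
      by (intro exI[of _ "insert (W \<inter> U) F"])
        (auto simp: cellular_family_def pairwise_insert disjnt_def card_insert_if)
  qed
  have "infinite (Field (chat X))"
  proof
    assume fin: "finite (Field (chat X))"
    obtain F where F: "cellular_family X F" "finite F" "card F = card (Field (chat X))"
      using split[of "topspace X" "card (Field (chat X))"] assms(3) by auto
    then have "|F| =o |Field (chat X)|"
      using fin by (metis card_of_ordIso bij_betw_iff_card)
    then have "|F| =o chat X"
      using card_of_Field_ordIso[OF chat(1)] ordIso_transitive by blast
    then show False
      using chat(2) F(1) by blast
  qed
  then show ?thesis
    using chat(1) by (simp add: cinfinite_def)
qed

section \<open>The nodes as an abstract tree, and the images they define\<close>

context nonconstant_family
begin

lemma node_image:
  obtains Y :: "'a topology"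
  where "crowded Y" "tychonov Y" "nowhere_constant_image X Y" "weight Y \<le>o |nodes <+> (UNIV :: nat set)|"
proof -
  have "continuous_map X euclideanreal h" if "h \<in> g ` nodes" for h
    using that continuous openin_node node_nonempty by auto
  moreover have "\<exists>h\<in>g ` nodes. \<not> h constant_on U" if "openin X U" "U \<noteq> {}" for U
    using nodes_separate[OF that] by auto
  ultimately obtain Y :: "'a topology" where Y: "crowded Y" "tychonov Y" "nowhere_constant_image X Y"
    "weight Y \<le>o |g ` nodes <+> (UNIV :: nat set)|"
    by (rule evaluation_image) blast
  have "|g ` nodes <+> (UNIV :: nat set)| \<le>o |nodes <+> (UNIV :: nat set)|"
    by (rule card_of_Plus_mono1[OF card_of_image])
  then show ?thesis
    using that[OF Y(1-3)] Y(4) ordLeq_transitive by blast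
qed

text \<open>The carrier is an index set rather than the nodes themselves, so that the tree can be
  placed on the type of points.\<close>

definition node_order :: "('c \<Rightarrow> 'a set) \<Rightarrow> 'c set \<Rightarrow> 'c rel" where
  "node_order k A = {(a, b). a \<in> A \<and> b \<in> A \<and> k b \<subseteq> k a}"

lemma Field_node_order: "Field (node_order k A) = A"
  by (auto simp: node_order_def Field_def)

text \<open>A point \<open>q\<close> of the node of \<open>t\<close> lies in all nodes above it, so
  \<open>node_below_max\<close> applies to every non-empty set of predecessors. The largest node is
  the least element in the tree order, which gives both well-foundedness and, for pairs,
  totality.\<close>

lemma is_tree_node_order:
  assumes "inj_on k A" "k ` A \<subseteq> nodes"
  shows "is_tree (node_order k A)"
  unfolding is_tree_def
proof (intro conjI ballI)
  let ?r = "node_order k A"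
  show po: "Partial_order ?r"
    using assms(1) Field_node_order[of k A]
    by (auto simp: order_on_defs node_order_def refl_on_def trans_def antisym_def inj_on_def)
  fix t assume "t \<in> Field ?r"
  then have t: "t \<in> A" by (simp add: Field_node_order)
  have S: "underS ?r t \<subseteq> A" "\<And>s. s \<in> underS ?r t \<Longrightarrow> k t \<subseteq> k s"
    by (auto simp: underS_def node_order_def)
  obtain q where q: "q \<in> k t" "q \<in> topspace X"
    using t assms(2) node_nonempty openin_node openin_subset by (metis ex_in_conv image_subset_iff subsetD)
  have max: "\<exists>m\<in>Q. \<forall>s\<in>Q. (m, s) \<in> ?r" if Q: "Q \<subseteq> underS ?r t" "Q \<noteq> {}" for Q
  proof -
    have "k ` Q \<subseteq> nodes" "k ` Q \<noteq> {}" "\<And>W. W \<in> k ` Q \<Longrightarrow> q \<in> W"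
      using Q S assms(2) q(1) by blast+
    then obtain M where M: "M \<in> k ` Q" "\<And>W. W \<in> k ` Q \<Longrightarrow> W \<subseteq> M"
      using node_below_max[OF _ _ q(2), of "k ` Q"] by metis
    then obtain m where "m \<in> Q" "M = k m" by blast
    then show ?thesis
      using M(2) Q(1) S(1) by (intro bexI[of _ m]) (auto simp: node_order_def)
  qed
  have "wf (Restr ?r (underS ?r t) - Id)"
    unfolding wf_eq_minimal2
  proof (intro allI impI)
    fix Q assume Q: "Q \<subseteq> Field (Restr ?r (underS ?r t) - Id) \<and> Q \<noteq> {}"
    then have "Q \<subseteq> underS ?r t"
      by (auto simp: Field_def)
    then obtain m where "m \<in> Q" "\<forall>s\<in>Q. (m, s) \<in> ?r"
      using max Q by blast
    then show "\<exists>m\<in>Q. \<forall>s\<in>Q. (s, m) \<notin> Restr ?r (underS ?r t) - Id"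
      using antisymD[of ?r] po by (auto simp: order_on_defs)
  qed
  moreover have "total_on (underS ?r t) (Restr ?r (underS ?r t))"
    unfolding total_on_def
  proof (intro ballI impI)
    fix a b assume ab: "a \<in> underS ?r t" "b \<in> underS ?r t"
    then obtain m where "m \<in> {a, b}" "\<forall>s\<in>{a, b}. (m, s) \<in> ?r"
      using max[of "{a, b}"] by blast
    then show "(a, b) \<in> Restr ?r (underS ?r t) \<or> (b, a) \<in> Restr ?r (underS ?r t)"
      using ab by auto
  qed
  moreover have "refl_on (underS ?r t) (Restr ?r (underS ?r t))"
    using S(1) by (auto simp: refl_on_def node_order_def)
  ultimately show "well_order_on (underS ?r t) (Restr ?r (underS ?r t))"
    using po by (auto simp: order_on_defs intro: trans_Restr antisym_Restr)
qed

lemma node_order_chain: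
  assumes "inj_on k A" "k ` A \<subseteq> nodes" "C \<in> Chains (node_order k A)"
  shows "|C| <o chat X"
proof -
  have C: "C \<subseteq> A" "\<And>a b. a \<in> C \<Longrightarrow> b \<in> C \<Longrightarrow> k a \<subseteq> k b \<or> k b \<subseteq> k a"
    using assms(3) by (auto simp: Chains_def node_order_def)
  then have "|k ` C| <o chat X"
    using assms(2) by (intro node_chain_card) blast+
  then show ?thesis
    using card_of_ordIsoI[OF inj_on_imp_bij_betw[OF inj_on_subset[OF assms(1) C(1)]]]
      ordIso_ordLess_trans by blast
qed

lemma node_order_antichain:
  assumes "inj_on k A" "k ` A \<subseteq> nodes" "antichain_in (node_order k A) C"
  shows "|C| <o chat X"
proof -
  have C: "C \<subseteq> A"
    using assms(3) by (simp add: antichain_in_def Field_node_order)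
  have "a = b" if "a \<in> C" "b \<in> C" "k a \<subseteq> k b" for a b
  proof -
    have "(b, a) \<in> node_order k A"
      using that C by (auto simp: node_order_def)
    then show ?thesis
      using assms(3) that unfolding antichain_in_def by metis
  qed
  moreover have "k ` C \<subseteq> nodes"
    using assms(2) C by blast
  ultimately have "|k ` C| <o chat X"
    by (intro node_antichain_card) auto
  then show ?thesis
    using card_of_ordIsoI[OF inj_on_imp_bij_betw[OF inj_on_subset[OF assms(1) C]]]
      ordIso_ordLess_trans by blast
qed

lemma card_nodes_le:
  assumes "Cinfinite (chat X)"
  shows "|nodes| \<le>o chat X"
proof -
  have id: "inj_on id nodes" "id ` nodes \<subseteq> nodes" by auto
  have "|Field (node_order id nodes)| \<le>o chat X"
    using node_order_chain[OF id] node_order_antichain[OF id]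
    by (intro card_tree_le is_tree_node_order id assms) blast+
  then show ?thesis
    by (simp add: Field_node_order)
qed

text \<open>The chain of nodes through a point has fewer than \<open>\<kappa>\<close> elements, so \<open>\<kappa>\<close> many nodes need
  \<open>\<kappa>\<close> many points.\<close>

lemma Suslin_tree_of_nodes:
  fixes \<kappa> :: "'k rel"
  assumes \<kappa>: "Cinfinite \<kappa>" "regularCard \<kappa>" "chat X =o \<kappa>" and large: "\<not> |nodes| <o \<kappa>"
  shows "\<exists>T :: 'a rel. Suslin_tree \<kappa> T"
proof -
  have less: "|C| <o \<kappa>" if "|C| <o chat X" for C :: "'c set"
    using that \<kappa>(3) ordLess_ordIso_trans by blast
  have "nodes = (\<Union>x\<in>topspace X. {U \<in> nodes. x \<in> U})"
    using node_nonempty openin_node openin_subset by fastforce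
  moreover have "|{U \<in> nodes. x \<in> U}| <o \<kappa>" for x
    by (intro less node_chain_card node_comparable) (auto simp: disjnt_def)
  ultimately have "\<not> |topspace X| <o \<kappa>"
    using large stable_UNION[OF regularCard_stable, of \<kappa> "topspace X" "\<lambda>x. {U \<in> nodes. x \<in> U}"] \<kappa>
    by (auto simp: cinfinite_def)
  then have "\<kappa> \<le>o |topspace X|"
    using \<kappa>(1) not_ordLess_card by blast
  moreover have "Cinfinite (chat X)"
    using Cinfinite_cong[OF ordIso_symmetric[OF \<kappa>(3)] \<kappa>(1)] .
  then have "|nodes| \<le>o \<kappa>"
    using card_nodes_le ordLeq_ordIso_trans \<kappa>(3) by blast
  ultimately have "|nodes| \<le>o |topspace X|"
    using ordLeq_transitive by blast
  then obtain h where h: "inj_on h nodes" "h ` nodes \<subseteq> topspace X"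
    using card_of_ordLeq by metis
  define k where "k = inv_into nodes h"
  have k: "inj_on k (h ` nodes)" "k ` h ` nodes = nodes"
    using h(1) by (auto simp: k_def inj_on_inv_into intro!: image_eqI)
  let ?T = "node_order k (h ` nodes)"
  have tree: "is_tree ?T"
    using k by (intro is_tree_node_order) auto
  have chains: "\<forall>C\<in>Chains ?T. |C| <o \<kappa>"
    using node_order_chain[OF k(1)] k(2) less by blast
  have antichains: "antichain_in ?T A \<Longrightarrow> |A| <o \<kappa>" for A
    using node_order_antichain[OF k(1)] k(2) less by blast
  have "|nodes| =o |Field ?T|"
    unfolding Field_node_order by (rule card_of_ordIsoI[OF inj_on_imp_bij_betw[OF h(1)]])
  then have "\<not> |Field ?T| <o \<kappa>"
    using large ordIso_ordLess_trans by blast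
  then have "has_height ?T \<kappa>"
    by (intro has_height_tree tree \<kappa> chains antichains)
  then show ?thesis
    using tree chains antichains unfolding Suslin_tree_def by blast
qed

end

lemma weight_empty:
  assumes "topspace X = {}"
  shows "weight X \<le>o |A|"
proof -
  have "base_of X {}"
    using assms by (auto simp: base_of_def dest: openin_subset)
  then show ?thesis
    using weight(3) card_of_empty ordLeq_transitive by metis
qed

lemma nowhere_constant_image_weight_le_chat:
  fixes X :: "'a topology"
  assumes "crowded X" "tychonov X"
  shows "\<exists>Y :: 'a topology. crowded Y \<and> tychonov Y \<and> nowhere_constant_image X Y \<and> weight Y \<le>o chat X"
proof (cases "topspace X = {}")
  \<comment> \<open>For the empty space \<open>chat\<close> is finite, so a bound through an
    infinite cardinal is too weak; the space is its own image, with an empty base.\<close>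
  case True
  have "weight X \<le>o chat X"
    using weight_empty[OF True, of "Field (chat X)"] card_of_Field_ordIso[OF chat(1)[of X]]
      ordLeq_ordIso_trans by blast
  moreover have "nowhere_constant_image X X"
    using True openin_subset unfolding nowhere_constant_image_def nowhere_constant_def
    by (intro exI[of _ id]) auto
  ultimately show ?thesis
    using assms by blast
next
  case False
  obtain g where "nonconstant_family X g"
    using ex_nonconstant_family[OF assms] .
  then interpret nonconstant_family X g .
  obtain Y :: "'a topology" where Y: "crowded Y" "tychonov Y" "nowhere_constant_image X Y"
    "weight Y \<le>o |nodes <+> (UNIV :: nat set)|"
    using node_image .
  have inf: "Cinfinite (chat X)"
    using infinite_chat assms False unfolding tychonov_def by blast
  have "|UNIV :: nat set| \<le>o chat X"
    by (rule ordIso_ordLeq_trans[OF card_of_nat natLeq_ordLeq_cinfinite[OF inf]])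
  then have "|nodes <+> (UNIV :: nat set)| \<le>o chat X"
    using inf card_nodes_le[OF inf]
    by (intro card_of_Plus_ordLeq_infinite_Field) (auto simp: cinfinite_def)
  then have "weight Y \<le>o chat X"
    using Y(4) ordLeq_transitive by blast
  then show ?thesis using Y by blast
qed

lemma nowhere_constant_image_weight_less:
  fixes X :: "'a topology" and \<kappa> :: "'k rel"
  assumes "crowded X" "tychonov X" "chat X =o \<kappa>" "uncountable_regular \<kappa>"
    and no_tree: "\<not> (\<exists>T :: 'a rel. Suslin_tree \<kappa> T)"
  shows "\<exists>Y :: 'a topology. crowded Y \<and> tychonov Y \<and> nowhere_constant_image X Y \<and> weight Y <o \<kappa>"
proof -
  have \<kappa>: "Card_order \<kappa>" "natLeq <o \<kappa>" "regularCard \<kappa>"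
    using assms(4) by (auto simp: uncountable_regular_def)
  then have inf: "Cinfinite \<kappa>"
    using cinfinite_mono natLeq_cinfinite ordLess_imp_ordLeq by blast
  obtain g where "nonconstant_family X g"
    using ex_nonconstant_family[OF assms(1,2)] .
  then interpret nonconstant_family X g .
  obtain Y :: "'a topology" where Y: "crowded Y" "tychonov Y" "nowhere_constant_image X Y"
    "weight Y \<le>o |nodes <+> (UNIV :: nat set)|"
    using node_image .
  have "|nodes| <o \<kappa>"
    using Suslin_tree_of_nodes[OF inf \<kappa>(3) assms(3)] no_tree by blast
  moreover have "|UNIV :: nat set| <o \<kappa>"
    by (rule ordIso_ordLess_trans[OF card_of_nat \<kappa>(2)])
  ultimately have "|nodes <+> (UNIV :: nat set)| <o \<kappa>"
    using inf by (intro card_of_Plus_ordLess_infinite_Field) (auto simp: cinfinite_def)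
  then have "weight Y <o \<kappa>"
    using Y(4) ordLeq_ordLess_trans by blast
  then show ?thesis using Y by blast
qed

section \<open>Linearly ordered spaces\<close>

lemma dyadic_between:
  fixes a b :: real
  assumes "0 \<le> a" "a < b"
  obtains t where "t \<in> dyadics" "a < t" "t < b"
proof -
  have "0 < b - a" "(1 :: real) < 2" using assms by auto
  then obtain n q s where "real q / 2 ^ n \<le> a" "a < real s / 2 ^ n" "\<bar>real q / 2 ^ n - real s / 2 ^ n\<bar> < b - a"
    using assms(1) by (rule padic_rational_approximation_straddle_pos_le)
  then have "a < real s / 2 ^ n" "real s / 2 ^ n < b" by linarith+
  moreover have "real s / 2 ^ n \<in> dyadics"
    unfolding dyadics_def by blast
  ultimately show ?thesis using that by blast
qed

locale linear_order_space =
  fixes r :: "'a rel"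
  assumes linear: "Linear_order r"
begin

definition lt :: "'a \<Rightarrow> 'a \<Rightarrow> bool" where
  "lt x y \<longleftrightarrow> (x, y) \<in> r \<and> x \<noteq> y"

abbreviation L :: "'a topology" where
  "L \<equiv> order_topology_of r"

lemma order_facts: "refl_on (Field r) r" "trans r" "antisym r" "total_on (Field r) r"
  using linear by (simp_all add: order_on_defs)

lemma le_refl: "x \<in> Field r \<Longrightarrow> (x, x) \<in> r"
  using order_facts(1) by (simp add: refl_on_def)

lemma le_trans: "(x, y) \<in> r \<Longrightarrow> (y, z) \<in> r \<Longrightarrow> (x, z) \<in> r"
  by (rule transD[OF order_facts(2)])

lemma le_antisym: "(x, y) \<in> r \<Longrightarrow> (y, x) \<in> r \<Longrightarrow> x = y"
  by (rule antisymD[OF order_facts(3)])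

lemma le_Field: "(x, y) \<in> r \<Longrightarrow> x \<in> Field r \<and> y \<in> Field r"
  by (auto simp: Field_def)

lemma lt_Field: "lt x y \<Longrightarrow> x \<in> Field r \<and> y \<in> Field r"
  using le_Field by (auto simp: lt_def)

lemma lt_trans: "lt x y \<Longrightarrow> lt y z \<Longrightarrow> lt x z"
  unfolding lt_def using le_trans le_antisym by metis

lemma lt_le_trans: "lt x y \<Longrightarrow> (y, z) \<in> r \<Longrightarrow> lt x z"
  unfolding lt_def using le_trans le_antisym by metis

lemma le_lt_trans: "(x, y) \<in> r \<Longrightarrow> lt y z \<Longrightarrow> lt x z"
  unfolding lt_def using le_trans le_antisym by metis

lemma lt_irrefl: "\<not> lt x x"
  by (simp add: lt_def)

lemma not_le: "x \<in> Field r \<Longrightarrow> y \<in> Field r \<Longrightarrow> (x, y) \<notin> r \<longleftrightarrow> lt y x"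
  using order_facts(4) le_refl[of x] le_antisym[of x y] unfolding lt_def total_on_def by metis

lemma not_lt: "x \<in> Field r \<Longrightarrow> y \<in> Field r \<Longrightarrow> \<not> lt x y \<longleftrightarrow> (y, x) \<in> r"
  using not_le[of y x] by metis

lemma lt_linear: "x \<in> Field r \<Longrightarrow> y \<in> Field r \<Longrightarrow> x \<noteq> y \<Longrightarrow> lt x y \<or> lt y x"
  using not_le[of x y] by (auto simp: lt_def)

lemma openin_lower_ray: "a \<in> Field r \<Longrightarrow> openin L {x. lt x a}"
  and openin_upper_ray: "a \<in> Field r \<Longrightarrow> openin L {x. lt a x}"
  unfolding order_topology_of_def lt_def by (rule topology_generated_by_Basis, blast)+

lemma openin_L_Field: "openin L U \<Longrightarrow> x \<in> U \<Longrightarrow> x \<in> Field r"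
  using openin_subset[of L U] by (auto simp: topspace_order_topology_of)

text \<open>An induction rule for neighbourhoods of a fixed \<open>x\<close>: a property closed
  under intersections and supersets has to be checked only on the carrier and the rays through
  \<open>x\<close>.\<close>

lemma openin_L_cases:
  assumes "openin L U" "x \<in> U"
    and "P (Field r)" "\<And>a. lt x a \<Longrightarrow> P {y. lt y a}" "\<And>a. lt a x \<Longrightarrow> P {y. lt a y}"
    and "\<And>U V. P U \<Longrightarrow> P V \<Longrightarrow> P (U \<inter> V)" "\<And>U V. P U \<Longrightarrow> U \<subseteq> V \<Longrightarrow> P V"
  shows "P U"
proof -
  let ?S = "{Field r} \<union> {{x. (x, a) \<in> r \<and> x \<noteq> a} |a. a \<in> Field r}
    \<union> {{x. (a, x) \<in> r \<and> x \<noteq> a} |a. a \<in> Field r}"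
  have "generate_topology_on ?S U"
    using assms(1) unfolding order_topology_of_def openin_topology_generated_by_iff .
  then show ?thesis
    using assms(2)
  proof (induction rule: generate_topology_on.induct)
    case (Int a b)
    then show ?case using assms(6) by simp
  next
    case (UN K)
    then show ?case using assms(7) by (metis UnionE Union_upper)
  next
    case (Basis s)
    then consider "s = Field r" | a where "s = {y. lt y a}" | a where "s = {y. lt a y}"
      unfolding lt_def by blast
    then show ?case
      using Basis(2) assms(3-5) by cases auto
  qed simp
qed

lemma openin_contains_left:
  assumes "openin L U" "x \<in> U" "lt y x"
  shows "\<exists>a. lt a x \<and> (\<forall>z. lt a z \<and> (z, x) \<in> r \<longrightarrow> z \<in> U)"
  using assms(1,2)
proof (rule openin_L_cases)
  show "\<exists>a. lt a x \<and> (\<forall>z. lt a z \<and> (z, x) \<in> r \<longrightarrow> z \<in> Field r)"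
    using assms(3) lt_Field by blast
  show "\<exists>a. lt a x \<and> (\<forall>z. lt a z \<and> (z, x) \<in> r \<longrightarrow> z \<in> {y. lt y c})" if "lt x c" for c
    using assms(3) le_lt_trans[OF _ that] by blast
  show "\<exists>a. lt a x \<and> (\<forall>z. lt a z \<and> (z, x) \<in> r \<longrightarrow> z \<in> {y. lt c y})" if "lt c x" for c
    using that by blast
  fix U V
  assume "\<exists>a. lt a x \<and> (\<forall>z. lt a z \<and> (z, x) \<in> r \<longrightarrow> z \<in> U)"
    and "\<exists>a. lt a x \<and> (\<forall>z. lt a z \<and> (z, x) \<in> r \<longrightarrow> z \<in> V)"
  then obtain a b where a: "lt a x" "\<And>z. lt a z \<Longrightarrow> (z, x) \<in> r \<Longrightarrow> z \<in> U"
    and b: "lt b x" "\<And>z. lt b z \<Longrightarrow> (z, x) \<in> r \<Longrightarrow> z \<in> V"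
    by auto
  define m where "m = (if lt a b then b else a)"
  have m: "lt m x" using a b by (simp add: m_def)
  have "(a, m) \<in> r" "(b, m) \<in> r"
    using a(1) b(1) lt_Field le_refl not_lt by (auto simp: m_def lt_def)
  then have "lt m z \<Longrightarrow> lt a z \<and> lt b z" for z
    using le_lt_trans by blast
  then show "\<exists>a. lt a x \<and> (\<forall>z. lt a z \<and> (z, x) \<in> r \<longrightarrow> z \<in> U \<inter> V)"
    using a b m by (intro exI[of _ m]) auto
next
  fix U V assume "\<exists>a. lt a x \<and> (\<forall>z. lt a z \<and> (z, x) \<in> r \<longrightarrow> z \<in> U)" "U \<subseteq> V"
  then show "\<exists>a. lt a x \<and> (\<forall>z. lt a z \<and> (z, x) \<in> r \<longrightarrow> z \<in> V)"
    by (meson subsetD)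
qed

definition cvx :: "'a set \<Rightarrow> bool" where
  "cvx J \<longleftrightarrow> J \<subseteq> Field r \<and> (\<forall>x\<in>J. \<forall>y\<in>J. \<forall>z. (x, z) \<in> r \<longrightarrow> (z, y) \<in> r \<longrightarrow> z \<in> J)"

lemma cvxD: "cvx J \<Longrightarrow> x \<in> J \<Longrightarrow> y \<in> J \<Longrightarrow> (x, z) \<in> r \<Longrightarrow> (z, y) \<in> r \<Longrightarrow> z \<in> J"
  unfolding cvx_def by metis

lemma cvxI:
  assumes "J \<subseteq> Field r" "\<And>x y z. x \<in> J \<Longrightarrow> y \<in> J \<Longrightarrow> (x, z) \<in> r \<Longrightarrow> (z, y) \<in> r \<Longrightarrow> z \<in> J"
  shows "cvx J"
  unfolding cvx_def using assms by metis

lemma cvx_Int: "cvx J \<Longrightarrow> cvx K \<Longrightarrow> cvx (J \<inter> K)"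
proof (rule cvxI)
  show "J \<inter> K \<subseteq> Field r" if "cvx J"
    using that unfolding cvx_def by (meson inf.coboundedI1)
  show "z \<in> J \<inter> K" if "cvx J" "cvx K" "x \<in> J \<inter> K" "y \<in> J \<inter> K" "(x, z) \<in> r" "(z, y) \<in> r" for x y z
    using that cvxD[of J x y z] cvxD[of K x y z] by simp
qed

lemma convex_neighbourhood:
  assumes "openin L U" "x \<in> U"
  shows "\<exists>J. openin L J \<and> cvx J \<and> x \<in> J \<and> J \<subseteq> U"
  using assms(1,2)
proof (rule openin_L_cases)
  have x: "x \<in> Field r"
    using assms by (rule openin_L_Field)
  have "cvx (Field r)"
    using le_Field by (auto simp: cvx_def)
  then show "\<exists>J. openin L J \<and> cvx J \<and> x \<in> J \<and> J \<subseteq> Field r"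
    using x openin_topspace[of L] by (auto simp: topspace_order_topology_of)
  fix c
  have "cvx {y. lt y c}" "cvx {y. lt c y}"
    unfolding cvx_def by (auto intro: le_lt_trans lt_le_trans dest: lt_Field)
  moreover have "c \<in> Field r" if "lt x c \<or> lt c x"
    using that lt_Field by blast
  ultimately show "lt x c \<Longrightarrow> \<exists>J. openin L J \<and> cvx J \<and> x \<in> J \<and> J \<subseteq> {y. lt y c}"
    and "lt c x \<Longrightarrow> \<exists>J. openin L J \<and> cvx J \<and> x \<in> J \<and> J \<subseteq> {y. lt c y}"
    using openin_lower_ray[of c] openin_upper_ray[of c] by blast+
next
  fix U V
  assume "\<exists>J. openin L J \<and> cvx J \<and> x \<in> J \<and> J \<subseteq> U" "\<exists>J. openin L J \<and> cvx J \<and> x \<in> J \<and> J \<subseteq> V"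
  then obtain J K where "openin L J" "cvx J" "x \<in> J" "J \<subseteq> U" "openin L K" "cvx K" "x \<in> K" "K \<subseteq> V"
    by blast
  then show "\<exists>J. openin L J \<and> cvx J \<and> x \<in> J \<and> J \<subseteq> U \<inter> V"
    using cvx_Int by (intro exI[of _ "J \<inter> K"]) auto
next
  fix U V assume "\<exists>J. openin L J \<and> cvx J \<and> x \<in> J \<and> J \<subseteq> U" "U \<subseteq> V"
  then show "\<exists>J. openin L J \<and> cvx J \<and> x \<in> J \<and> J \<subseteq> V"
    by (meson order_trans)
qed

section \<open>Real functions on a linear order; the Tychonov property\<close>

text \<open>At a jump from \<open>p\<close> to \<open>q\<close> the points from \<open>q\<close>
  upwards form a set that is both open and closed, so its indicator function is continuous.\<close>

lemma separating_function_jump: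
  assumes "(a, p) \<in> r" "lt p q" "(q, b) \<in> r" "\<And>z. \<not> (lt p z \<and> lt z q)"
  shows "\<exists>f. continuous_map L euclideanreal f \<and> (\<forall>x. (x, a) \<in> r \<longrightarrow> f x = 0) \<and> (\<forall>x. (b, x) \<in> r \<longrightarrow> f x = 1)"
proof (intro exI conjI allI impI)
  let ?f = "\<lambda>x. if (q, x) \<in> r then 1 else 0 :: real"
  have pq: "p \<in> Field r" "q \<in> Field r"
    using assms(2) lt_Field by blast+
  have eq: "{x. (q, x) \<in> r} = {x. lt p x}"
    using assms(2,4) pq lt_le_trans lt_Field not_lt by blast
  have eq2: "{x \<in> Field r. (q, x) \<notin> r} = {x. lt x q}"
    using pq not_le lt_Field by blast
  show "continuous_map L euclideanreal ?f"
    unfolding continuous_map_upper_lower_semicontinuous_lt topspace_order_topology_of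
  proof (intro allI conjI)
    fix c :: real
    have "{x \<in> Field r. c < ?f x} = (if c < 0 then Field r else if c < 1 then {x. lt p x} else {})"
      using eq le_Field by auto
    then show "openin L {x \<in> Field r. c < ?f x}"
      using openin_upper_ray[OF pq(1)] openin_topspace[of L] by (auto simp: topspace_order_topology_of)
    have "{x \<in> Field r. ?f x < c} = (if 1 < c then Field r else if 0 < c then {x. lt x q} else {})"
      using eq2 by auto
    then show "openin L {x \<in> Field r. ?f x < c}"
      using openin_lower_ray[OF pq(2)] openin_topspace[of L] by (auto simp: topspace_order_topology_of)
  qed
  show "?f x = 0" if "(x, a) \<in> r" for x
    using le_trans[OF that] assms(1,2) lt_irrefl le_lt_trans lt_le_trans by metis
  show "?f x = 1" if "(b, x) \<in> r" for x
    using le_trans assms(3) that by simp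
qed

text \<open>Urysohn's construction inside the order: dense order allows an increasing map
  \<open>e\<close> from the dyadic fractions of the unit interval into the interval from
  \<open>a\<close> to \<open>b\<close>, and \<open>f x\<close> is the supremum of the dyadics whose
  image is at most \<open>x\<close>.\<close>

lemma separating_function_dense:
  assumes ab: "lt a b" and dense: "\<And>x y. (a, x) \<in> r \<Longrightarrow> lt x y \<Longrightarrow> (y, b) \<in> r \<Longrightarrow> \<exists>z. lt x z \<and> lt z y"
  shows "\<exists>f. continuous_map L euclideanreal f \<and> (\<forall>x. (x, a) \<in> r \<longrightarrow> f x = 0) \<and> (\<forall>x. (b, x) \<in> r \<longrightarrow> f x = 1)"
proof -
  define R where "R x y \<longleftrightarrow> (a, x) \<in> r \<and> lt x y \<and> (y, b) \<in> r" for x y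
  have R: "R a b"
    using ab le_refl lt_Field by (auto simp: R_def)
  have R_dense: "\<exists>z. R x z \<and> R z y" if xy: "R x y" for x y
  proof -
    obtain z where "lt x z" "lt z y"
      using dense[of x y] xy by (auto simp: R_def)
    then have "R x z \<and> R z y"
      using xy le_trans unfolding R_def lt_def by metis
    then show ?thesis ..
  qed
  have R_trans: "R x z" if "R x y" "R y z" for x y z
    using that lt_trans unfolding R_def by metis
  obtain e :: "real \<Rightarrow> 'a" where e01: "e 0 = a" "e 1 = b"
    and e_mono: "\<forall>x\<in>dyadics \<inter> {0..1}. \<forall>y\<in>dyadics \<inter> {0..1}. x < y \<longrightarrow> R (e x) (e y)"
  proof -
    have "\<exists>e :: real \<Rightarrow> 'a. e 0 = a \<and> e 1 = b \<and>
        (\<forall>x\<in>dyadics \<inter> {0..1}. \<forall>y\<in>dyadics \<inter> {0..1}. x < y \<longrightarrow> R (e x) (e y))"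
      by (rule recursion_on_dyadic_fractions[of R, OF R]) (erule R_dense, erule (1) R_trans)
    then show ?thesis by (elim exE conjE) (rule that)
  qed
  define D where "D = (dyadics \<inter> {0..1} :: real set)"
  have e: "lt (e s) (e t)" if "s \<in> D" "t \<in> D" "s < t" for s t
    using e_mono that
    by (auto simp: D_def R_def)
  have "(0 :: real) = real 0" "(1 :: real) = real 1" by simp_all
  then have D01: "0 \<in> D" "1 \<in> D"
    unfolding D_def using real_in_dyadics by (metis Int_iff atLeastAtMost_iff order_refl zero_le_one)+
  have D_pos: "0 \<le> t" "t \<le> 1" if "t \<in> D" for t
    using that by (auto simp: D_def)
  have eF: "e t \<in> Field r" if "t \<in> D" for t
    using e[OF that D01(2)] e01 ab lt_Field D_pos[OF that] by (cases "t = 1") auto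
  \<comment> \<open>Inserting 0 gives the supremum a value also for points strictly left of
    \<open>a\<close>, where no dyadic qualifies.\<close>
  define f where "f x = Sup (insert 0 {t \<in> D. (e t, x) \<in> r})" for x
  have bdd: "bdd_above (insert 0 {t \<in> D. (e t, x) \<in> r})" for x
    using D_pos by (intro bdd_aboveI[of _ 1]) auto
  have f_ge: "t \<le> f x" if "t \<in> D" "(e t, x) \<in> r" for t x
    unfolding f_def using bdd that by (intro cSup_upper) auto
  have f_le: "f x \<le> t" if "t \<in> D" "lt x (e t)" for t x
    unfolding f_def
  proof (rule cSup_least)
    fix s assume s: "s \<in> insert 0 {t \<in> D. (e t, x) \<in> r}"
    show "s \<le> t"
    proof (rule ccontr)
      assume "\<not> s \<le> t"
      then have "s \<in> D" "(e s, x) \<in> r" "t < s"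
        using s D_pos[OF that(1)] by auto
      then show False
        using e[OF that(1)] that(2) lt_trans le_lt_trans lt_irrefl by metis
    qed
  qed simp
  have f_nonneg: "0 \<le> f x" for x
    unfolding f_def using bdd by (intro cSup_upper) auto
  have f_le1: "f x \<le> 1" for x
    unfolding f_def using D_pos by (intro cSup_least) auto
  have "continuous_map L euclideanreal f"
    unfolding continuous_map_upper_lower_semicontinuous_lt topspace_order_topology_of
  proof (intro allI conjI)
    fix c :: real
    show "openin L {x \<in> Field r. c < f x}"
    proof (cases "c < 0")
      case True
      then have "{x \<in> Field r. c < f x} = topspace L"
        using f_nonneg by (force simp: topspace_order_topology_of intro: less_le_trans)
      then show ?thesis using openin_topspace by metis
    next
      case False
      have "{x \<in> Field r. c < f x} = (\<Union>s\<in>{s \<in> D. c < s}. {x. lt (e s) x})"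
      proof
        show "{x \<in> Field r. c < f x} \<subseteq> (\<Union>s\<in>{s \<in> D. c < s}. {x. lt (e s) x})"
        proof
          fix x assume x: "x \<in> {x \<in> Field r. c < f x}"
          then obtain t where t: "t \<in> D" "(e t, x) \<in> r" "c < t"
            using less_cSup_iff[OF _ bdd, of x c] False by (auto simp: f_def)
          \<comment> \<open>A further dyadic below \<open>t\<close> turns the weak inequality
            between \<open>e t\<close> and \<open>x\<close> into the strict one required by an open
            ray.\<close>
          obtain s where s: "s \<in> dyadics" "c < s" "s < t"
            using dyadic_between[of c t] False t(3) by auto
          then have "s \<in> D" using D_pos[OF t(1)] False by (auto simp: D_def)
          then show "x \<in> (\<Union>s\<in>{s \<in> D. c < s}. {x. lt (e s) x})"
            using e[OF _ t(1)] s t(2) lt_le_trans by blast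
        qed
        show "(\<Union>s\<in>{s \<in> D. c < s}. {x. lt (e s) x}) \<subseteq> {x \<in> Field r. c < f x}"
          using f_ge lt_Field by (force simp: lt_def)
      qed
      then show ?thesis
        using openin_upper_ray eF by auto
    qed
    show "openin L {x \<in> Field r. f x < c}"
    proof (cases "1 < c")
      case True
      then have "{x \<in> Field r. f x < c} = topspace L"
        using f_le1 by (force simp: topspace_order_topology_of intro: le_less_trans)
      then show ?thesis using openin_topspace by metis
    next
      case False
      have "{x \<in> Field r. f x < c} = (\<Union>s\<in>{s \<in> D. s < c}. {x. lt x (e s)})"
      proof
        show "{x \<in> Field r. f x < c} \<subseteq> (\<Union>s\<in>{s \<in> D. s < c}. {x. lt x (e s)})"
        proof
          fix x assume x: "x \<in> {x \<in> Field r. f x < c}"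
          obtain s where s: "s \<in> dyadics" "f x < s" "s < c"
            using dyadic_between[of "f x" c] f_nonneg x by auto
          then have "s \<in> D" using f_nonneg[of x] False by (auto simp: D_def)
          then have "lt x (e s)"
            using f_ge s(2) x eF not_le by (metis (no_types, lifting) leD mem_Collect_eq)
          then show "x \<in> (\<Union>s\<in>{s \<in> D. s < c}. {x. lt x (e s)})"
            using \<open>s \<in> D\<close> s(3) by blast
        qed
        show "(\<Union>s\<in>{s \<in> D. s < c}. {x. lt x (e s)}) \<subseteq> {x \<in> Field r. f x < c}"
          using f_le lt_Field by (fastforce intro: le_less_trans)
      qed
      then show ?thesis
        using openin_lower_ray eF by auto
    qed
  qed
  moreover have "f x = 0" if x: "(x, a) \<in> r" for x
  proof -
    have "t = 0" if t: "t \<in> D" "(e t, x) \<in> r" for t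
    proof (rule ccontr)
      assume "t \<noteq> 0"
      then have "lt a (e t)"
        using e[OF D01(1) t(1)] D_pos[OF t(1)] e01 by auto
      then show False
        using t(2) x le_trans lt_le_trans lt_irrefl by metis
    qed
    then have "insert 0 {t \<in> D. (e t, x) \<in> r} = {0}" by auto
    then show ?thesis
      unfolding f_def by (simp only: cSup_singleton)
  qed
  moreover have "f x = 1" if "(b, x) \<in> r" for x
    using f_ge[OF D01(2), of x] f_le1[of x] that unfolding e01(2) by (metis order_antisym)
  ultimately show ?thesis by blast
qed

lemma separating_function:
  assumes "lt a b"
  obtains f where "continuous_map L euclideanreal f"
    "\<forall>x. (x, a) \<in> r \<longrightarrow> f x = 0" "\<forall>x. (b, x) \<in> r \<longrightarrow> f x = 1"
proof (cases "\<exists>p q. (a, p) \<in> r \<and> lt p q \<and> (q, b) \<in> r \<and> (\<forall>z. \<not> (lt p z \<and> lt z q))")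
  case True
  then obtain p q where "(a, p) \<in> r" "lt p q" "(q, b) \<in> r" "\<And>z. \<not> (lt p z \<and> lt z q)"
    by metis
  from separating_function_jump[OF this] show ?thesis
    by (elim exE conjE) (rule that)
next
  case False
  then have dense: "\<exists>z. lt x z \<and> lt z y" if "(a, x) \<in> r" "lt x y" "(y, b) \<in> r" for x y
    using that by metis
  have "\<exists>f. continuous_map L euclideanreal f \<and> (\<forall>x. (x, a) \<in> r \<longrightarrow> f x = 0) \<and> (\<forall>x. (b, x) \<in> r \<longrightarrow> f x = 1)"
    by (rule separating_function_dense[OF assms]) (erule (2) dense)
  then show ?thesis
    by (elim exE conjE) (rule that)
qed

lemma tychonov_L: "tychonov L"
  unfolding tychonov_def
proof
  show "completely_regular_space L"
    unfolding order_topology_of_def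
  proof (rule completely_regular_generated, fold order_topology_of_def)
    let ?S = "{Field r} \<union> {{x. (x, a) \<in> r \<and> x \<noteq> a} |a. a \<in> Field r}
      \<union> {{x. (a, x) \<in> r \<and> x \<noteq> a} |a. a \<in> Field r}"
    have S: "\<Union>?S = Field r"
      using topspace_order_topology_of[of r] unfolding order_topology_of_def by simp
    fix s x assume s: "s \<in> ?S" "x \<in> s"
    then consider "s = Field r" | a where "s = {y. lt y a}" | a where "s = {y. lt a y}"
      unfolding lt_def by blast
    then show "\<exists>f. continuous_map L euclideanreal f \<and> f x \<le> 0 \<and> (\<forall>y\<in>\<Union>?S - s. 1 \<le> f y)"
      unfolding S
    proof cases
      case 1
      then show "\<exists>f. continuous_map L euclideanreal f \<and> f x \<le> 0 \<and> (\<forall>y\<in>Field r - s. 1 \<le> f y)"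
        by (intro exI[of _ "\<lambda>_. 0"]) auto
    next
      case (2 a)
      then have xa: "lt x a" using s(2) by simp
      obtain f where f: "continuous_map L euclideanreal f"
          "\<forall>y. (y, x) \<in> r \<longrightarrow> f y = 0" "\<forall>y. (a, y) \<in> r \<longrightarrow> f y = 1"
        by (rule separating_function[OF xa])
      have "f x = 0" "\<And>y. y \<in> Field r - s \<Longrightarrow> f y = 1"
        using f(2,3) le_refl lt_Field[OF xa] not_lt 2 by auto
      then show "\<exists>f. continuous_map L euclideanreal f \<and> f x \<le> 0 \<and> (\<forall>y\<in>Field r - s. 1 \<le> f y)"
        using f(1) by (intro exI[of _ f]) simp
    next
      case (3 a)
      then have ax: "lt a x" using s(2) by simp
      obtain f where f: "continuous_map L euclideanreal f"
          "\<forall>y. (y, a) \<in> r \<longrightarrow> f y = 0" "\<forall>y. (x, y) \<in> r \<longrightarrow> f y = 1"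
        by (rule separating_function[OF ax])
      have "f x = 1" "\<And>y. y \<in> Field r - s \<Longrightarrow> f y = 0"
        using f(2,3) le_refl lt_Field[OF ax] not_lt 3 by auto
      then show "\<exists>f. continuous_map L euclideanreal f \<and> f x \<le> 0 \<and> (\<forall>y\<in>Field r - s. 1 \<le> f y)"
        using f(1) by (intro exI[of _ "\<lambda>y. 1 - f y"]) (auto intro: continuous_map_diff)
    qed
  qed
  show "Hausdorff_space L"
    unfolding Hausdorff_space_def topspace_order_topology_of
  proof (intro allI impI)
    have *: "\<exists>U V. openin L U \<and> openin L V \<and> x \<in> U \<and> y \<in> V \<and> disjnt U V" if xy: "lt x y" for x y
    proof -
      obtain f where f: "continuous_map L euclideanreal f"
          "\<forall>z. (z, x) \<in> r \<longrightarrow> f z = 0" "\<forall>z. (y, z) \<in> r \<longrightarrow> f z = 1"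
        by (rule separating_function[OF xy])
      have "f x = 0" "f y = 1"
        using f(2,3) le_refl lt_Field[OF xy] by auto
      moreover have "openin L {z \<in> Field r. f z < 1/2}" "openin L {z \<in> Field r. 1/2 < f z}"
        using f(1) unfolding continuous_map_upper_lower_semicontinuous_lt topspace_order_topology_of
        by blast+
      ultimately show ?thesis
        using lt_Field[OF xy]
        by (intro exI[of _ "{z \<in> Field r. f z < 1/2}"] exI[of _ "{z \<in> Field r. 1/2 < f z}"])
          (auto simp: disjnt_def)
    qed
    fix x y assume "x \<in> Field r \<and> y \<in> Field r \<and> x \<noteq> y"
    then have "lt x y \<or> lt y x"
      using lt_linear by metis
    then show "\<exists>U V. openin L U \<and> openin L V \<and> x \<in> U \<and> y \<in> V \<and> disjnt U V"
      using *[of x y] *[of y x] disjnt_sym by metis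
  qed
qed

section \<open>Convex components and small dense sets\<close>

lemma cvx_Union:
  assumes "\<And>J. J \<in> F \<Longrightarrow> cvx J" "\<And>J. J \<in> F \<Longrightarrow> x \<in> J"
  shows "cvx (\<Union>F)"
proof (rule cvxI)
  show "\<Union>F \<subseteq> Field r"
    using assms(1) by (auto simp: cvx_def)
  fix a b z assume "a \<in> \<Union>F" "b \<in> \<Union>F" and z: "(a, z) \<in> r" "(z, b) \<in> r"
  then obtain J K where J: "J \<in> F" "a \<in> J" and K: "K \<in> F" "b \<in> K"
    by auto
  have "x \<in> Field r"
    using assms J(1) unfolding cvx_def by (metis subsetD)
  then have "(z, x) \<in> r \<or> (x, z) \<in> r"
    using z(1) le_Field not_le unfolding lt_def by metis
  then have "z \<in> J \<or> z \<in> K"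
    using cvxD[OF assms(1)[OF J(1)] J(2) assms(2)[OF J(1)] z(1)]
      cvxD[OF assms(1)[OF K(1)] assms(2)[OF K(1)] K(2) _ z(2)] by metis
  then show "z \<in> \<Union>F"
    using J(1) K(1) by auto
qed

text \<open>The convex component of \<open>x\<close> in \<open>U\<close>. The components of an open
  set partition it into open sets, so there are fewer than \<open>chat L\<close> of them.\<close>

definition component :: "'a set \<Rightarrow> 'a \<Rightarrow> 'a set" where
  "component U x = \<Union>{J. openin L J \<and> cvx J \<and> x \<in> J \<and> J \<subseteq> U}"

lemma component_subset: "component U x \<subseteq> U"
  by (auto simp: component_def)

lemma openin_component: "openin L (component U x)"
  unfolding component_def by (rule openin_Union) auto

lemma cvx_component: "cvx (component U x)"
  unfolding component_def by (rule cvx_Union[where x = x]) auto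

lemma component_maximal: "openin L J \<Longrightarrow> cvx J \<Longrightarrow> x \<in> J \<Longrightarrow> J \<subseteq> U \<Longrightarrow> J \<subseteq> component U x"
  by (auto simp: component_def)

lemma component_self: "openin L U \<Longrightarrow> x \<in> U \<Longrightarrow> x \<in> component U x"
  using convex_neighbourhood[of U x] component_maximal by (metis subsetD)

lemma component_eq_or_disjnt:
  assumes "openin L U" "x \<in> U" "y \<in> U"
  shows "component U x = component U y \<or> disjnt (component U x) (component U y)"
proof (cases "disjnt (component U x) (component U y)")
  case False
  then obtain z where z: "z \<in> component U x" "z \<in> component U y"
    by (auto simp: disjnt_def)
  define C where "C = \<Union>{component U x, component U y}"
  have "cvx C"
    unfolding C_def using z cvx_component by (intro cvx_Union[where x = z]) auto
  moreover have "openin L C" "C \<subseteq> U"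
    unfolding C_def using openin_component component_subset by auto
  moreover have "x \<in> C" "y \<in> C"
    using component_self assms by (auto simp: C_def)
  ultimately have "C \<subseteq> component U x" "C \<subseteq> component U y"
    using component_maximal by auto
  then show ?thesis
    by (auto simp: C_def)
qed simp

lemma cellular_components:
  assumes "openin L U"
  shows "cellular_family L (component U ` U)"
  unfolding cellular_family_def pairwise_image
proof (intro conjI ballI)
  fix J assume "J \<in> component U ` U"
  then show "openin L J" "J \<noteq> {}"
    using openin_component component_self[OF assms] by auto
next
  show "pairwise (\<lambda>x y. component U x \<noteq> component U y \<longrightarrow> disjnt (component U x) (component U y)) U"
    unfolding pairwise_def using component_eq_or_disjnt[OF assms] by metis
qed

text \<open>Crowdedness is applied twice: for a second point, and again in the part of
  \<open>J\<close> above the smaller of the two. This leaves room on both sides of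
  \<open>z\<close>.\<close>

lemma open_three_points:
  assumes "crowded L" "openin L J" "J \<noteq> {}"
  obtains p z q where "p \<in> J" "z \<in> J" "q \<in> J" "lt p z" "lt z q"
proof -
  have J: "J \<subseteq> Field r"
    using openin_subset[OF assms(2)] by (simp add: topspace_order_topology_of)
  obtain x where x: "x \<in> J" using assms(3) by auto
  obtain y where "y \<in> J" "y \<noteq> x"
    using crowded_point[OF assms(1,2) x] .
  then obtain p q where pq: "p \<in> J" "q \<in> J" "lt p q"
    using lt_linear x J by (metis subsetD)
  have "openin L (J \<inter> {w. lt p w})"
    using assms(2) openin_upper_ray pq J by (intro openin_Int) auto
  then obtain w where "w \<in> J \<inter> {w. lt p w}" "w \<noteq> q"
    using crowded_point[OF assms(1), of "J \<inter> {w. lt p w}" q] pq by auto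
  then have w: "w \<in> J" "lt p w" "w \<noteq> q" by auto
  then have "lt w q \<or> lt q w"
    using lt_linear pq(2) J by (metis subsetD)
  then show ?thesis
    using that pq w by metis
qed

text \<open>Convex components of preimages of basic open sets have two sides each; as \<open>f\<close> is nowhere
  constant, the resulting initial segments split every non-empty open set. Picking one point between
  any two of them gives a dense set.\<close>

lemma small_dense_subset:
  fixes \<kappa> :: "'k rel" and Y :: "'b topology"
  assumes crowded: "crowded L" and f: "continuous_map L Y f" "nowhere_constant L f"
    and Y: "Hausdorff_space Y" "base_of Y B"
    and \<kappa>: "Cinfinite \<kappa>" "regularCard \<kappa>" "|B| <o \<kappa>"
    and cellular: "\<And>F. cellular_family L F \<Longrightarrow> |F| <o \<kappa>"
  shows "\<exists>D. dense_subset L D \<and> |D| <o \<kappa>"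
proof -
  have inf: "\<not> finite (Field \<kappa>)" "Card_order \<kappa>"
    using \<kappa>(1) by (auto simp: cinfinite_def)
  define pre where "pre V = {x \<in> topspace L. f x \<in> V}" for V
  have open_pre: "openin L (pre V)" if "V \<in> B" for V
    unfolding pre_def using f(1) Y(2) that
    by (intro openin_continuous_map_preimage) (auto simp: base_of_def)
  define K where "K = (\<Union>V\<in>B. component (pre V) ` pre V)"
  \<comment> \<open>By regularity: there are fewer than \<kappa> base sets, and the preimage of each
    has fewer than \<kappa> components.\<close>
  have "|K| <o \<kappa>"
    unfolding K_def using \<kappa> inf cellular cellular_components open_pre
    by (intro stable_UNION regularCard_stable) auto
  define lower where "lower Q = {y \<in> Field r. \<forall>q\<in>Q. lt y q}" for Q
  define upto where "upto Q = {y \<in> Field r. \<exists>q\<in>Q. (y, q) \<in> r}" for Q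
  define Cuts where "Cuts = lower ` K \<union> upto ` K"
  have "|lower ` K| <o \<kappa>" "|upto ` K| <o \<kappa>"
    using card_of_image ordLeq_ordLess_trans[OF _ \<open>|K| <o \<kappa>\<close>] by auto
  then have card_Cuts: "|Cuts| <o \<kappa>"
    unfolding Cuts_def using \<kappa>(1) by (intro Un_Cinfinite_bound_strict)
  have down: "y \<in> S" if "S \<in> Cuts" "x \<in> S" "(y, x) \<in> r" for S x y
  proof -
    obtain Q where "S = lower Q \<or> S = upto Q"
      using \<open>S \<in> Cuts\<close> by (auto simp: Cuts_def)
    moreover have "y \<in> Field r" using le_Field that(3) by auto
    ultimately show ?thesis
      using that(2) le_lt_trans[OF that(3)] le_trans[OF that(3)] by (auto simp: lower_def upto_def)
  qed
  \<comment> \<open>Two points of \<open>I\<close> with different images are told apart by a base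
    set. The component around \<open>x\<close> of its preimage misses \<open>y\<close>; by convexity
    \<open>y\<close> lies entirely on one side of this component, and the cut on that side separates
    the two points.\<close>
  have split: "\<exists>S\<in>Cuts. \<exists>x\<in>I. \<exists>y\<in>I. x \<in> S \<and> y \<notin> S" if I: "openin L I" "I \<noteq> {}" for I
  proof -
    have IF: "I \<subseteq> Field r" "I \<subseteq> topspace L"
      using openin_subset[OF I(1)] by (simp_all add: topspace_order_topology_of)
    have "\<not> f constant_on I"
      using f(2) I by (simp add: nowhere_constant_def)
    then obtain x y where xy: "x \<in> I" "y \<in> I" "f x \<noteq> f y"
      unfolding constant_on_def by metis
    then have "f x \<in> topspace Y" "f y \<in> topspace Y"
      using f(1) IF(2) by (auto dest: continuous_map_image_subset_topspace)
    then obtain W W' where W: "openin Y W" "f x \<in> W" "f y \<in> W'" "disjnt W W'"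
      using Y(1) xy(3) unfolding Hausdorff_space_def by metis
    then obtain V where V: "V \<in> B" "f x \<in> V" "V \<subseteq> W"
      using Y(2) unfolding base_of_def by metis
    define Q where "Q = component (pre V) x"
    have x: "x \<in> pre V" using V xy IF by (auto simp: pre_def)
    then have "Q \<in> K" "x \<in> Q"
      using V(1) component_self[OF open_pre] by (auto simp: K_def Q_def)
    have "f y \<notin> V" using W(3,4) V(3) by (auto simp: disjnt_def)
    then have "y \<notin> Q"
      using component_subset[of "pre V" x] by (auto simp: Q_def pre_def)
    have convex: "cvx Q" by (simp add: Q_def cvx_component)
    have xyF: "x \<in> Field r" "y \<in> Field r" using xy IF by auto
    have QF: "Q \<subseteq> Field r" using convex by (simp add: cvx_def)
    have "x \<noteq> y" using xy(3) by auto
    then consider "lt x y" | "lt y x" using lt_linear xyF by metis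
    then show ?thesis
    proof cases
      case 1
      have "y \<notin> upto Q"
        using cvxD[OF convex \<open>x \<in> Q\<close>, of _ y] 1 \<open>y \<notin> Q\<close> by (auto simp: upto_def lt_def)
      moreover have "x \<in> upto Q"
        using le_refl xyF \<open>x \<in> Q\<close> by (auto simp: upto_def)
      ultimately show ?thesis
        using xy \<open>Q \<in> K\<close> by (intro bexI[of _ "upto Q"]) (auto simp: Cuts_def)
    next
      case 2
      have "lt y q" if "q \<in> Q" for q
      proof (rule ccontr)
        assume "\<not> lt y q"
        then have "(q, y) \<in> r" using not_lt xyF that QF by auto
        then show False
          using cvxD[OF convex that \<open>x \<in> Q\<close>] 2 \<open>y \<notin> Q\<close> by (auto simp: lt_def)
      qed
      then have "y \<in> lower Q" using xyF by (simp add: lower_def)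
      moreover have "x \<notin> lower Q"
        using \<open>x \<in> Q\<close> lt_irrefl by (auto simp: lower_def)
      ultimately show ?thesis
        using xy \<open>Q \<in> K\<close> by (intro bexI[of _ "lower Q"]) (auto simp: Cuts_def)
    qed
  qed
  have Cuts_Field: "S \<subseteq> Field r" if "S \<in> Cuts" for S
    using that by (auto simp: Cuts_def lower_def upto_def)
  define pick where "pick = (\<lambda>(S, S'). SOME d :: 'a. d \<in> S' - S)"
  define D where "D = pick ` {(S, S'). S \<in> Cuts \<and> S' \<in> Cuts \<and> S' - S \<noteq> {}}"
  have pick: "pick (S, S') \<in> S' - S" if "S' - S \<noteq> {}" for S S' :: "'a set"
    unfolding pick_def using that some_in_eq by (metis case_prod_conv)
  have "dense_subset L D"
    unfolding dense_subset_def dense_intersects_open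
  proof (intro conjI allI impI)
    show "D \<subseteq> topspace L"
    proof
      fix d assume "d \<in> D"
      then obtain S S' where "S' \<in> Cuts" "S' - S \<noteq> {}" "d = pick (S, S')"
        by (auto simp: D_def)
      then show "d \<in> topspace L"
        using pick[of S' S] Cuts_Field[of S'] by (auto simp: topspace_order_topology_of)
    qed
    fix V assume V: "openin L V \<and> V \<noteq> {}"
    then obtain x where "x \<in> V" by auto
    then obtain J where J: "openin L J" "cvx J" "x \<in> J" "J \<subseteq> V"
      using convex_neighbourhood[of V x] V by metis
    have "J \<noteq> {}" using J(3) by auto
    then obtain p z q where pzq: "p \<in> J" "z \<in> J" "q \<in> J" "lt p z" "lt z q"
      by (rule open_three_points[OF crowded J(1)])
    have zF: "z \<in> Field r" using pzq(4) lt_Field by auto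
    \<comment> \<open>One cut is taken on each side of \<open>z\<close>. The left cut
      \<open>S\<close> omits \<open>z\<close> and the right cut \<open>S'\<close> contains it, so
      their difference is non-empty; all its points lie between \<open>x1\<close> and
      \<open>y3\<close>, hence in \<open>J\<close>.\<close>
    have "openin L (J \<inter> {y. lt y z})" "openin L (J \<inter> {y. lt z y})"
      using openin_Int[OF J(1)] openin_lower_ray[OF zF] openin_upper_ray[OF zF] by auto
    moreover have "J \<inter> {y. lt y z} \<noteq> {}" "J \<inter> {y. lt z y} \<noteq> {}"
      using pzq by auto
    ultimately have "\<exists>S\<in>Cuts. \<exists>x\<in>J \<inter> {y. lt y z}. \<exists>y\<in>J \<inter> {y. lt y z}. x \<in> S \<and> y \<notin> S"
      and "\<exists>S\<in>Cuts. \<exists>x\<in>J \<inter> {y. lt z y}. \<exists>y\<in>J \<inter> {y. lt z y}. x \<in> S \<and> y \<notin> S"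
      using split by simp_all
    then obtain S x1 y1 S' x3 y3
      where S: "S \<in> Cuts" "x1 \<in> J \<inter> {y. lt y z}" "y1 \<in> J \<inter> {y. lt y z}" "x1 \<in> S" "y1 \<notin> S"
        and S': "S' \<in> Cuts" "x3 \<in> J \<inter> {y. lt z y}" "y3 \<in> J \<inter> {y. lt z y}" "x3 \<in> S'" "y3 \<notin> S'"
      by (elim bexE conjE) (rule that)
    have "z \<in> S'"
      using down[OF S'(1,4)] S'(2) by (auto simp: lt_def)
    moreover have "z \<notin> S"
      using down[OF S(1), of z y1] S(3,5) by (auto simp: lt_def)
    ultimately have d: "pick (S, S') \<in> S' - S"
      by (intro pick) auto
    then have dF: "pick (S, S') \<in> Field r" using Cuts_Field S'(1) by auto
    have "lt x1 (pick (S, S'))"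
      using down[OF S(1,4), of "pick (S, S')"] d not_le[of "pick (S, S')" x1] dF lt_Field S(2) by auto
    moreover have "lt (pick (S, S')) y3"
      using down[OF S'(1), of "pick (S, S')" y3] d S'(5) not_le[of y3 "pick (S, S')"] dF lt_Field S'(3)
        down[OF S'(1), of y3 "pick (S, S')"] by auto
    ultimately have "pick (S, S') \<in> J"
      using cvxD[OF J(2), of x1 y3 "pick (S, S')"] S(2) S'(3) by (auto simp: lt_def)
    moreover have "pick (S, S') \<in> D"
      unfolding D_def using S(1) S'(1) d by auto
    ultimately show "D \<inter> V \<noteq> {}"
      using J(4) by auto
  qed
  moreover have "|D| <o \<kappa>"
  proof -
    have "|Cuts \<times> Cuts| <o \<kappa>"
      using \<kappa> inf card_Cuts by (intro stable_elim[OF regularCard_stable]) auto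
    moreover have "D \<subseteq> pick ` (Cuts \<times> Cuts)"
      by (auto simp: D_def)
    ultimately show ?thesis
      using card_of_mono1 card_of_image ordLeq_transitive ordLeq_ordLess_trans by metis
  qed
  ultimately show ?thesis by auto
qed

lemma Suslin_line_no_small_image:
  fixes \<kappa> :: "'k rel" and Y :: "'b topology"
  assumes "Suslin_line \<kappa> r" "uncountable_regular \<kappa>" "Hausdorff_space Y" "nowhere_constant_image L Y"
  shows "\<not> weight Y <o \<kappa>"
proof
  assume less: "weight Y <o \<kappa>"
  have line: "crowded L" "chat L =o \<kappa>" "\<kappa> \<le>o density L"
    using assms(1) by (auto simp: Suslin_line_def)
  have \<kappa>: "Cinfinite \<kappa>" "regularCard \<kappa>"
    using assms(2) cinfinite_mono natLeq_cinfinite ordLess_imp_ordLeq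
    unfolding uncountable_regular_def by metis+
  obtain f where f: "continuous_map L Y f" "nowhere_constant L f"
    using assms(4) unfolding nowhere_constant_image_def by metis
  obtain B where B: "base_of Y B" "|B| =o weight Y"
    using weight(2) by metis
  have "\<exists>D. dense_subset L D \<and> |D| <o \<kappa>"
  proof (rule small_dense_subset[OF line(1) f assms(3) B(1) \<kappa>])
    show "|B| <o \<kappa>"
      using B(2) less by (rule ordIso_ordLess_trans)
    show "|F| <o \<kappa>" if "cellular_family L F" for F
      using cellular_less_chat[OF that] line(2) by (rule ordLess_ordIso_trans)
  qed
  then obtain D where D: "dense_subset L D" "|D| <o \<kappa>" by auto
  then have "\<kappa> \<le>o |D|"
    using line(3) density(3) ordLeq_transitive by metis
  then show False
    using D(2) not_ordLess_ordLeq by metis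
qed

end

section \<open>Order reversal; densely ordered lines are crowded\<close>

lemma order_topology_of_converse: "order_topology_of (r\<inverse>) = order_topology_of r"
  by (simp add: order_topology_of_def Un_ac)

lemma (in linear_order_space) openin_contains_right:
  assumes "openin L U" "x \<in> U" "lt x y"
  shows "\<exists>b. lt x b \<and> (\<forall>z. lt z b \<and> (x, z) \<in> r \<longrightarrow> z \<in> U)"
proof -
  interpret converse: linear_order_space "r\<inverse>"
    using linear by unfold_locales simp
  have "converse.lt = (\<lambda>a b. lt b a)"
    by (auto simp: converse.lt_def lt_def fun_eq_iff)
  then show ?thesis
    using converse.openin_contains_left[of U x y] assms by (simp add: order_topology_of_converse)
qed

lemma (in linear_order_space) crowded_dense_order:
  assumes dense: "\<And>x y. lt x y \<Longrightarrow> \<exists>z. lt x z \<and> lt z y"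
    and two: "\<And>x. x \<in> Field r \<Longrightarrow> \<exists>y\<in>Field r. y \<noteq> x"
  shows "crowded L"
  unfolding crowded_def topspace_order_topology_of
proof (intro ballI notI)
  fix x assume x: "x \<in> Field r" "openin L {x}"
  obtain y where y: "y \<in> Field r" "y \<noteq> x" using two x(1) by metis
  then consider "lt y x" | "lt x y" using lt_linear x(1) by metis
  then show False
  proof cases
    case 1
    then obtain a where a: "lt a x" "\<And>z. lt a z \<and> (z, x) \<in> r \<Longrightarrow> z = x"
      using openin_contains_left[OF x(2), of x] by auto
    then obtain z where "lt a z" "lt z x" using dense by metis
    then show False using a(2) by (auto simp: lt_def)
  next
    case 2
    then obtain a where a: "lt x a" "\<And>z. lt z a \<and> (x, z) \<in> r \<Longrightarrow> z = x"
      using openin_contains_right[OF x(2), of x] by auto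
    then obtain z where "lt x z" "lt z a" using dense by metis
    then show False using a(2) by (auto simp: lt_def)
  qed
qed

section \<open>The lexicographic order of a tree\<close>

text \<open>The auxiliary order \<open>w\<close> serves to decide between nodes with the same strict
  predecessors; no compatibility with the tree order is assumed.\<close>

locale ordered_tree =
  fixes t w :: "'a rel"
  assumes tree: "is_tree t" and w: "trans w" "antisym w" "total_on UNIV w"
begin

lemma t_refl: "x \<in> Field t \<Longrightarrow> (x, x) \<in> t"
  using tree by (simp add: is_tree_def order_on_defs refl_on_def)

lemma t_trans: "(x, y) \<in> t \<Longrightarrow> (y, z) \<in> t \<Longrightarrow> (x, z) \<in> t"
  using tree unfolding is_tree_def order_on_defs by (elim conjE) (rule transD)

lemma t_antisym: "(x, y) \<in> t \<Longrightarrow> (y, x) \<in> t \<Longrightarrow> x = y"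
  using tree unfolding is_tree_def order_on_defs by (elim conjE) (rule antisymD)

lemma t_Field: "(x, y) \<in> t \<Longrightarrow> x \<in> Field t" "(x, y) \<in> t \<Longrightarrow> y \<in> Field t"
  by (auto simp: Field_def)

lemma t_least:
  assumes "\<And>s. s \<in> S \<Longrightarrow> (s, x) \<in> t" "S \<noteq> {}"
  shows "\<exists>m\<in>S. \<forall>s\<in>S. (m, s) \<in> t"
proof (cases "S \<subseteq> {x}")
  case True
  then have "S = {x}" using assms(2) by auto
  then show ?thesis using assms(1) by auto
next
  case False
  \<comment> \<open>\<open>underS\<close> is strict, so \<open>x\<close>, possibly a member of
    \<open>S\<close>, is set aside before the well-order of the predecessors is used.\<close>
  define Q where "Q = S - {x}"
  have Q: "Q \<noteq> {}" "Q \<subseteq> underS t x"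
    using False assms(1) by (auto simp: Q_def underS_def)
  have xF: "x \<in> Field t" using assms t_Field(2) by auto
  note wo = tree_below(1)[OF tree xF]
  have "wf (Restr t (underS t x) - Id)" "total_on (underS t x) (Restr t (underS t x))"
    using wo by (simp_all add: order_on_defs)
  then obtain m where m: "m \<in> Q" "\<And>y. (y, m) \<in> Restr t (underS t x) - Id \<Longrightarrow> y \<notin> Q"
    using Q(1) by (metis ex_in_conv wfE_min)
  have "(m, s) \<in> t" if "s \<in> S" for s
  proof (cases "s = x")
    case True
    then show ?thesis using m(1) assms(1) by (auto simp: Q_def)
  next
    case False
    then have s: "s \<in> Q" using that by (simp add: Q_def)
    show ?thesis
    proof (cases "s = m")
      case True
      then show ?thesis using t_refl t_Field(1) assms(1) that by auto
    next
      case False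
      then have "(s, m) \<in> Restr t (underS t x) \<or> (m, s) \<in> Restr t (underS t x)"
        using \<open>total_on (underS t x) (Restr t (underS t x))\<close> s m(1) Q(2)
        unfolding total_on_def by (meson subsetD)
      then show ?thesis using m(2)[of s] s False by auto
    qed
  qed
  then show ?thesis using m(1) by (auto simp: Q_def)
qed

lemma t_comparable:
  assumes "(a, x) \<in> t" "(b, x) \<in> t"
  shows "(a, b) \<in> t \<or> (b, a) \<in> t"
  using t_least[of "{a, b}" x] assms by auto

lemma same_underS:
  assumes "underS t a = underS t b" "(a, x) \<in> t" "(b, x) \<in> t"
  shows "a = b"
proof (rule ccontr)
  assume "a \<noteq> b"
  then have "a \<in> underS t b \<or> b \<in> underS t a"
    using t_comparable[OF assms(2,3)] by (auto simp: underS_def)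
  then show False using assms(1) by (auto simp: underS_def)
qed

text \<open>The branches to \<open>x\<close> and \<open>y\<close> part at the nodes \<open>a\<close> and \<open>b\<close>.\<close>

definition split :: "'a \<Rightarrow> 'a \<Rightarrow> 'a \<Rightarrow> 'a \<Rightarrow> bool" where
  "split x y a b \<longleftrightarrow> (a, x) \<in> t \<and> (b, y) \<in> t \<and> underS t a = underS t b \<and> a \<noteq> b"

lemma split_common:
  assumes "split x y a b" "(c, x) \<in> t" "c \<noteq> a" "(c, a) \<in> t"
  shows "(c, b) \<in> t" "(c, y) \<in> t"
proof -
  have "c \<in> underS t b"
    using assms by (auto simp: split_def underS_def)
  then show "(c, b) \<in> t" by (simp add: underS_def)
  then show "(c, y) \<in> t"
    using assms(1) t_trans by (auto simp: split_def)
qed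

lemma split_sym: "split x y a b \<Longrightarrow> split y x b a"
  by (auto simp: split_def)

lemma split_not_below: "split x y a b \<Longrightarrow> (a, y) \<notin> t" "split x y a b \<Longrightarrow> (b, x) \<notin> t"
  unfolding split_def using same_underS by metis+

lemma split_incomparable: "split x y a b \<Longrightarrow> (x, y) \<notin> t" "split x y a b \<Longrightarrow> (y, x) \<notin> t"
  using split_not_below t_trans unfolding split_def by metis+

text \<open>Both \<open>a\<close> and \<open>c\<close> lie on the branch to \<open>x\<close>. If
  they differed, the earlier one would be a common predecessor for the other splitting and so lie
  below \<open>y\<close>, which \<open>split_not_below\<close> forbids.\<close>

lemma split_unique:
  assumes "split x y a b" "split x y c d"
  shows "a = c" "b = d"
proof -
  have ac: "(a, x) \<in> t" "(c, x) \<in> t"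
    using assms by (auto simp: split_def)
  then have "(a, c) \<in> t \<or> (c, a) \<in> t" by (rule t_comparable)
  then show eq: "a = c"
    using split_common(2)[OF assms(2) ac(1)] split_common(2)[OF assms(1) ac(2)]
      split_not_below(1)[OF assms(1)] split_not_below(1)[OF assms(2)] by metis
  show "b = d"
    using assms eq same_underS[of b d y] by (auto simp: split_def)
qed

text \<open>Take the least node on each branch that is not on the other; minimality makes their
  strict predecessors coincide. The tree may branch at limit levels, so there need not be a last
  common node to name instead.\<close>

lemma split_exists:
  assumes "x \<in> Field t" "y \<in> Field t" "(x, y) \<notin> t" "(y, x) \<notin> t"
  shows "\<exists>a b. split x y a b"
proof -
  have *: "\<exists>a. (a, x) \<in> t \<and> (a, y) \<notin> t \<and> (\<forall>u. (u, x) \<in> t \<and> (u, y) \<notin> t \<longrightarrow> (a, u) \<in> t)"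
    if "x \<in> Field t" "(x, y) \<notin> t" for x y
    using t_least[of "{u. (u, x) \<in> t \<and> (u, y) \<notin> t}" x] t_refl that by auto
  obtain a where a: "(a, x) \<in> t" "(a, y) \<notin> t" "\<And>u. (u, x) \<in> t \<Longrightarrow> (u, y) \<notin> t \<Longrightarrow> (a, u) \<in> t"
    using *[OF assms(1,3)] by auto
  obtain b where b: "(b, y) \<in> t" "(b, x) \<notin> t" "\<And>u. (u, y) \<in> t \<Longrightarrow> (u, x) \<notin> t \<Longrightarrow> (b, u) \<in> t"
    using *[OF assms(2,4)] by auto
  have "u \<in> underS t b" if "u \<in> underS t a" for u
  proof -
    have u: "(u, a) \<in> t" "u \<noteq> a" using that by (auto simp: underS_def)
    then have ux: "(u, x) \<in> t" using a(1) t_trans by metis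
    then have uy: "(u, y) \<in> t" using a(3) u t_antisym by metis
    have "(b, u) \<notin> t" using ux b(2) t_trans by metis
    then have "(u, b) \<in> t" using t_comparable[OF uy b(1)] by metis
    then show ?thesis using \<open>(b, u) \<notin> t\<close> by (auto simp: underS_def)
  qed
  moreover have "u \<in> underS t a" if "u \<in> underS t b" for u
  proof -
    have u: "(u, b) \<in> t" "u \<noteq> b" using that by (auto simp: underS_def)
    then have uy: "(u, y) \<in> t" using b(1) t_trans by metis
    then have ux: "(u, x) \<in> t" using b(3) u t_antisym by metis
    have "(a, u) \<notin> t" using uy a(2) t_trans by metis
    then have "(u, a) \<in> t" using t_comparable[OF ux a(1)] by metis
    then show ?thesis using \<open>(a, u) \<notin> t\<close> by (auto simp: underS_def)
  qed
  ultimately have "underS t a = underS t b" by auto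
  then have "split x y a b"
    using a(1,2) b(1,2) by (auto simp: split_def)
  then show ?thesis by auto
qed

text \<open>The lexicographic order of the nodes, with every node placed before its extensions in
  the tree.\<close>

definition lin :: "'a rel" where
  "lin = {(x, y). x \<in> Field t \<and> y \<in> Field t \<and> ((x, y) \<in> t \<or> (\<exists>a b. split x y a b \<and> (a, b) \<in> w))}"

lemma lin_of_t: "(x, y) \<in> t \<Longrightarrow> (x, y) \<in> lin"
  using t_Field by (auto simp: lin_def)

lemma lin_cases:
  assumes "(x, y) \<in> lin"
  obtains "(x, y) \<in> t" | a b where "split x y a b" "(a, b) \<in> w"
  using assms by (auto simp: lin_def)

lemma lin_of_split: "split x y a b \<Longrightarrow> (a, b) \<in> w \<Longrightarrow> (x, y) \<in> lin"
  using t_Field unfolding lin_def split_def by blast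

lemma lin_Field: "(x, y) \<in> lin \<Longrightarrow> x \<in> Field t" "(x, y) \<in> lin \<Longrightarrow> y \<in> Field t"
  by (auto simp: lin_def)

lemma Field_lin: "Field lin = Field t"
proof
  show "Field lin \<subseteq> Field t" by (auto simp: lin_def Field_def)
  show "Field t \<subseteq> Field lin" using lin_of_t t_refl by (auto intro: FieldI1)
qed

lemma split_mono:
  assumes "split x y a b" "(x, u) \<in> t"
  shows "split u y a b"
  using assms t_trans unfolding split_def by metis

text \<open>When both comparisons come from splittings, the nodes \<open>b\<close> and
  \<open>c\<close> lie on the branch to \<open>y\<close> and are comparable. The earlier one decides
  how \<open>x\<close> and \<open>z\<close> split; if they coincide, transitivity of
  \<open>w\<close> does.\<close>

lemma lin_trans:
  assumes xy: "(x, y) \<in> lin" and yz: "(y, z) \<in> lin"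
  shows "(x, z) \<in> lin"
  using xy
proof (cases rule: lin_cases)
  case x: 1
  show ?thesis using yz
  proof (cases rule: lin_cases)
    case 1
    then show ?thesis using x t_trans lin_of_t by metis
  next
    case (2 a b)
    show ?thesis
    proof (cases "(a, x) \<in> t")
      case True
      then have "split x z a b" using 2(1) by (auto simp: split_def)
      then show ?thesis using 2(2) by (rule lin_of_split)
    next
      case False
      then have "(x, a) \<in> t" "x \<noteq> a"
        using t_comparable[of x y a] x 2(1) t_refl t_Field(1) by (auto simp: split_def)
      then have "(x, z) \<in> t" using split_common(2)[OF 2(1) x] by auto
      then show ?thesis by (rule lin_of_t)
    qed
  qed
next
  case x: (2 a b)
  show ?thesis using yz
  proof (cases rule: lin_cases)
    case 1
    then have "split x z a b"
      using x(1) t_trans unfolding split_def by metis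
    then show ?thesis using x(2) by (rule lin_of_split)
  next
    case (2 c d)
    have bc: "(b, y) \<in> t" "(c, y) \<in> t" using x(1) 2(1) by (auto simp: split_def)
    consider "b = c" | "b \<noteq> c" "(b, c) \<in> t" | "b \<noteq> c" "(c, b) \<in> t"
      using t_comparable[OF bc] by auto
    then show ?thesis
    proof cases
      case 1
      have "(a, d) \<in> w" using x(2) 2(2) 1 transD[OF w(1)] by metis
      \<comment> \<open>Otherwise \<open>a\<close> and \<open>b\<close> would precede each other in
        \<open>w\<close> and be equal.\<close>
      moreover have "a \<noteq> d"
        using x 2 1 antisymD[OF w(2)] unfolding split_def by metis
      then have "split x z a d"
        using x(1) 2(1) 1 by (auto simp: split_def)
      ultimately show ?thesis using lin_of_split by metis
    next
      case bc_less: 2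
      then have "(b, z) \<in> t" using split_common(2)[OF 2(1) bc(1)] by auto
      then have "split x z a b" using x(1) by (auto simp: split_def)
      then show ?thesis using x(2) by (rule lin_of_split)
    next
      case 3
      then have "(c, x) \<in> t" using split_common(2)[OF split_sym[OF x(1)] bc(2)] by auto
      then have "split x z c d" using 2(1) by (auto simp: split_def)
      then show ?thesis using 2(2) by (rule lin_of_split)
    qed
  qed
qed

lemma lin_antisym:
  assumes xy: "(x, y) \<in> lin" and yx: "(y, x) \<in> lin"
  shows "x = y"
  using xy
proof (cases rule: lin_cases)
  case 1
  show ?thesis using yx
    by (cases rule: lin_cases) (use 1 t_antisym split_incomparable(2) in metis)+
next
  case (2 a b)
  show ?thesis using yx
  proof (cases rule: lin_cases)
    case 1
    then show ?thesis using split_incomparable(2)[OF 2(1)] by auto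
  next
    case (2 c d)
    then have "a = d" "b = c"
      using split_unique[OF split_sym[OF 2(1)] \<open>split x y a b\<close>] by auto
    then have "a = b" using 2(2) \<open>(a, b) \<in> w\<close> antisymD[OF w(2)] by metis
    then show ?thesis using \<open>split x y a b\<close> by (auto simp: split_def)
  qed
qed

lemma lin_total:
  assumes "x \<in> Field t" "y \<in> Field t"
  shows "(x, y) \<in> lin \<or> (y, x) \<in> lin"
proof (cases "(x, y) \<in> t \<or> (y, x) \<in> t")
  case True
  then show ?thesis using lin_of_t by auto
next
  case False
  then obtain a b where ab: "split x y a b" using split_exists assms by metis
  then have "(a, b) \<in> w \<or> (b, a) \<in> w"
    using w(3) by (auto simp: total_on_def split_def)
  then show ?thesis using ab split_sym lin_of_split by metis
qed

lemma Linear_order_lin: "Linear_order lin"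
proof -
  have "refl_on (Field lin) lin"
    using t_refl lin_of_t by (auto simp: refl_on_def Field_lin)
  moreover have "trans lin" using lin_trans by (rule transI)
  moreover have "antisym lin" using lin_antisym by (rule antisymI)
  moreover have "total_on (Field lin) lin"
    using lin_total by (auto simp: total_on_def Field_lin)
  moreover have "lin \<subseteq> Field lin \<times> Field lin" by (auto simp: Field_def)
  ultimately show ?thesis by (simp add: order_on_defs)
qed

text \<open>Extending \<open>a\<close> to \<open>u\<close> does not change the nodes at which it
  splits from \<open>b\<close>. Intervals therefore swallow whole cones, which links the size of
  intervals to the tree.\<close>

lemma cone_subset_interval:
  assumes "(a, b) \<in> lin" "(a, b) \<notin> t" "(a, u) \<in> t"
  shows "(a, u) \<in> lin" "(u, b) \<in> lin"
proof -
  show "(a, u) \<in> lin" using assms(3) by (rule lin_of_t)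
  obtain c d where "split a b c d" "(c, d) \<in> w"
    using assms(1,2) by (auto elim: lin_cases)
  then show "(u, b) \<in> lin"
    using split_mono assms(3) lin_of_split by metis
qed

text \<open>A node outside the cone of \<open>m\<close> compares in the same way with all its
  members: either it precedes \<open>m\<close> in the tree, hence all of them, or it splits from
  each of them at the same pair as from \<open>m\<close>.\<close>

lemma cone_convex:
  assumes "(m, x) \<in> t" "(m, z) \<in> t" "(x, y) \<in> lin" "(y, z) \<in> lin"
  shows "(m, y) \<in> t"
proof (rule ccontr)
  assume my: "(m, y) \<notin> t"
  have F: "m \<in> Field t" "y \<in> Field t" using assms t_Field(1) lin_Field by auto
  show False
  proof (cases "(y, m) \<in> t")
    case True
    then have "(y, x) \<in> lin" using assms(1) t_trans lin_of_t by metis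
    then show False using assms(1,3) lin_antisym my by metis
  next
    case False
    then obtain a b where ab: "split m y a b" using split_exists F my by metis
    then have "split x y a b" "split z y a b"
      using split_mono assms(1,2) by auto
    moreover have "(a, b) \<in> w"
      using assms(3) split_incomparable(1)[OF \<open>split x y a b\<close>] split_unique[OF \<open>split x y a b\<close>]
      by (auto elim: lin_cases)
    moreover have "(b, a) \<in> w"
      using assms(4) split_incomparable(2)[OF \<open>split z y a b\<close>]
        split_unique[OF split_sym[OF \<open>split z y a b\<close>]]
      by (auto elim: lin_cases)
    ultimately show False
      using antisymD[OF w(2)] by (auto simp: split_def)
  qed
qed

text \<open>Serves to cover \<open>P\<close> by the cones over an antichain, which turns bounds on
  antichains into bounds on sets of nodes.\<close>

lemma minimal_antichain:
  assumes "P \<subseteq> Field t"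
  obtains M where "M \<subseteq> P" "antichain_in t M" "\<And>p. p \<in> P \<Longrightarrow> \<exists>m\<in>M. (m, p) \<in> t"
proof -
  define M where "M = {m \<in> P. \<forall>p\<in>P. (p, m) \<in> t \<longrightarrow> p = m}"
  have "\<exists>m\<in>M. (m, p) \<in> t" if p: "p \<in> P" for p
  proof -
    have "{q \<in> P. (q, p) \<in> t} \<noteq> {}" using p t_refl assms by auto
    then obtain m where m: "m \<in> P" "(m, p) \<in> t" "\<And>q. q \<in> P \<Longrightarrow> (q, p) \<in> t \<Longrightarrow> (m, q) \<in> t"
      using t_least[of "{q \<in> P. (q, p) \<in> t}" p] by auto
    have "q = m" if "q \<in> P" "(q, m) \<in> t" for q
      using m(3)[OF that(1)] m(2) that(2) t_trans t_antisym by metis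
    then have "m \<in> M" using m(1) by (auto simp: M_def)
    then show ?thesis using m(2) by auto
  qed
  moreover have "antichain_in t M"
    using assms by (auto simp: antichain_in_def M_def)
  ultimately show ?thesis
    using that[of M] by (auto simp: M_def)
qed

end

section \<open>From Suslin trees to Suslin lines\<close>

locale large_ordered_tree = ordered_tree t w for t w :: "'a rel" +
  fixes \<kappa> :: "'k rel"
  assumes inf: "Cinfinite \<kappa>" and regular: "regularCard \<kappa>"
    and chains: "\<And>C. C \<in> Chains t \<Longrightarrow> |C| <o \<kappa>"
    and antichains: "\<And>A. antichain_in t A \<Longrightarrow> |A| <o \<kappa>"
    and large: "\<not> |Field t| <o \<kappa>"
begin

lemma stable: "stable \<kappa>"
  using inf regular by (intro regularCard_stable) (auto simp: cinfinite_def)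

lemma small_subset: "A \<subseteq> B \<Longrightarrow> |B| <o \<kappa> \<Longrightarrow> |A| <o \<kappa>"
  by (rule ordLeq_ordLess_trans[OF card_of_mono1])

lemma small_Un: "|A| <o \<kappa> \<Longrightarrow> |B| <o \<kappa> \<Longrightarrow> |A \<union> B| <o \<kappa>"
  using inf by (intro Un_Cinfinite_bound_strict)

lemma small_finite: "finite A \<Longrightarrow> |A| <o \<kappa>"
  by (rule finite_ordLess_infinite[OF card_of_Well_order])
    (use inf in \<open>auto simp: cinfinite_def Field_card_of card_order_on_def\<close>)

section \<open>Closeness classes of nodes\<close>

definition ivl :: "'a \<Rightarrow> 'a \<Rightarrow> 'a set" where
  "ivl a b = {z. (a, z) \<in> lin \<and> (z, b) \<in> lin}"

text \<open>Both orientations are required to make the relation symmetric; the interval taken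
  backwards has at most one element.\<close>

definition close :: "'a \<Rightarrow> 'a \<Rightarrow> bool" where
  "close a b \<longleftrightarrow> |ivl a b| <o \<kappa> \<and> |ivl b a| <o \<kappa>"

text \<open>This bounds closeness classes. A member of \<open>E\<close> with a larger member outside
  its cone has its cone inside a small interval; the minimal such members form an antichain, so
  fewer than \<kappa> small cones cover all of them. The remaining members form a chain.\<close>

lemma small_of_small_intervals:
  assumes E: "E \<subseteq> Field t" and small: "\<And>a b. a \<in> E \<Longrightarrow> b \<in> E \<Longrightarrow> |ivl a b| <o \<kappa>"
  shows "|E| <o \<kappa>"
proof -
  define P where "P = {a \<in> E. \<exists>b\<in>E. (a, b) \<in> lin \<and> (a, b) \<notin> t}"
  have "P \<subseteq> Field t" using E by (auto simp: P_def)
  then obtain M where M: "M \<subseteq> P" "antichain_in t M" "\<And>p. p \<in> P \<Longrightarrow> \<exists>m\<in>M. (m, p) \<in> t"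
    by (rule minimal_antichain) (rule that)
  have "|{u. (m, u) \<in> t}| <o \<kappa>" if "m \<in> M" for m
  proof -
    have "m \<in> P" using that M(1) by auto
    then obtain b where b: "m \<in> E" "b \<in> E" "(m, b) \<in> lin" "(m, b) \<notin> t"
      by (auto simp: P_def)
    have "{u. (m, u) \<in> t} \<subseteq> ivl m b"
      using cone_subset_interval[OF b(3,4)] by (auto simp: ivl_def)
    then show ?thesis using small[OF b(1,2)] by (rule small_subset)
  qed
  then have "|\<Union>m\<in>M. {u. (m, u) \<in> t}| <o \<kappa>"
    by (rule stable_UNION[OF stable antichains[OF M(2)]])
  then have "|P| <o \<kappa>"
    using M(3) by (intro small_subset[of P]) auto
  moreover have "(a, b) \<in> t \<or> (b, a) \<in> t" if "a \<in> E - P" "b \<in> E - P" for a b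
    using lin_total[of a b] that E by (auto simp: P_def)
  then have "E - P \<in> Chains t"
    by (simp add: Chains_def)
  then have "|E - P| <o \<kappa>" by (rule chains)
  ultimately have "|P \<union> (E - P)| <o \<kappa>" by (rule small_Un)
  then show ?thesis by (intro small_subset[of E]) auto
qed

lemma close_sym: "close a b \<Longrightarrow> close b a"
  by (simp add: close_def)

lemma ivl_backwards: "(a, b) \<in> lin \<Longrightarrow> ivl b a \<subseteq> {a}"
  using lin_trans lin_antisym by (fastforce simp: ivl_def)

lemma close_iff: "(a, b) \<in> lin \<Longrightarrow> close a b \<longleftrightarrow> |ivl a b| <o \<kappa>"
  using small_subset[OF ivl_backwards small_finite] by (auto simp: close_def)

lemma close_refl: "a \<in> Field t \<Longrightarrow> close a a"
  using ivl_backwards[of a a] lin_of_t t_refl small_subset[OF _ small_finite, of "ivl a a" "{a}"]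
  by (simp add: close_def)

lemma close_trans:
  assumes "close a b" "close b c" "b \<in> Field t"
  shows "close a c"
proof -
  have "ivl x z \<subseteq> ivl x b \<union> ivl b z" for x z
    using lin_total[OF _ assms(3)] lin_Field by (auto simp: ivl_def)
  then have "|ivl x z| <o \<kappa>" if "|ivl x b| <o \<kappa>" "|ivl b z| <o \<kappa>" for x z
    using small_subset[OF _ small_Un[OF that]] by auto
  then show ?thesis
    using assms(1,2) by (auto simp: close_def)
qed

lemma close_between:
  assumes "close a b" "(a, z) \<in> lin" "(z, b) \<in> lin"
  shows "close a z" "close z b"
proof -
  have "ivl a z \<subseteq> ivl a b" "ivl z b \<subseteq> ivl a b"
    using assms(2,3) lin_trans by (auto simp: ivl_def)
  then show "close a z" "close z b"
    using assms close_iff small_subset unfolding close_def by metis+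
qed

definition rep :: "'a \<Rightarrow> 'a" where
  "rep x = (SOME y. y \<in> Field t \<and> close x y)"

lemma rep: assumes "x \<in> Field t" shows "rep x \<in> Field t" "close x (rep x)"
  using someI[of "\<lambda>y. y \<in> Field t \<and> close x y" x] assms close_refl by (auto simp: rep_def)

lemma rep_eq_iff:
  assumes "x \<in> Field t" "y \<in> Field t"
  shows "rep x = rep y \<longleftrightarrow> close x y"
proof
  show "close x y" if "rep x = rep y"
    using rep[OF assms(1)] rep[OF assms(2)] that close_sym close_trans by metis
  assume "close x y"
  then have "close x z \<longleftrightarrow> close y z" for z
    using assms close_sym close_trans by metis
  then show "rep x = rep y" by (simp add: rep_def)
qed

lemma rep_rep: "x \<in> Field t \<Longrightarrow> rep (rep x) = rep x"
  using rep_eq_iff[of "rep x" x] rep[of x] close_sym[of x "rep x"] by auto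

definition reps :: "'a set" where
  "reps = rep ` Field t"

lemma reps_Field: "reps \<subseteq> Field t"
  using rep(1) by (auto simp: reps_def)

lemma reps_not_close:
  assumes "x \<in> reps" "y \<in> reps" "x \<noteq> y"
  shows "\<not> close x y"
proof -
  have "rep x = x" "rep y = y"
    using assms rep_rep by (auto simp: reps_def)
  then show ?thesis
    using assms rep_eq_iff[of x y] reps_Field by auto
qed

text \<open>Finitely many classes are too small to cover \<open>A\<close>. Having infinitely many
  allows the classes of two endpoints to be discarded later.\<close>

lemma infinite_reps:
  assumes "A \<subseteq> Field t" "\<not> |A| <o \<kappa>"
  shows "infinite (rep ` A)"
proof
  assume fin: "finite (rep ` A)"
  have "|{y \<in> Field t. close s y}| <o \<kappa>" if "s \<in> rep ` A" for s
  proof (rule small_of_small_intervals)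
    have s: "s \<in> Field t" using that assms(1) rep(1) by auto
    fix a b assume "a \<in> {y \<in> Field t. close s y}" "b \<in> {y \<in> Field t. close s y}"
    then have "close a b" using close_trans[OF close_sym _ s] by auto
    then show "|ivl a b| <o \<kappa>" by (simp add: close_def)
  qed auto
  then have "|\<Union>s\<in>rep ` A. {y \<in> Field t. close s y}| <o \<kappa>"
    by (rule stable_UNION[OF stable small_finite[OF fin]])
  moreover have "A \<subseteq> (\<Union>s\<in>rep ` A. {y \<in> Field t. close s y})"
  proof
    fix y assume y: "y \<in> A"
    then have "y \<in> Field t" using assms(1) by auto
    then have "close (rep y) y" using rep(2) close_sym by auto
    then show "y \<in> (\<Union>s\<in>rep ` A. {y \<in> Field t. close s y})"
      using y \<open>y \<in> Field t\<close> by auto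
  qed
  ultimately show False using assms(2) small_subset by metis
qed

lemma rep_between:
  assumes ab: "(a, b) \<in> lin" "\<not> close a b"
  obtains s where "s \<in> reps" "(a, s) \<in> lin" "(s, b) \<in> lin" "\<not> close a s" "\<not> close s b"
proof -
  have F: "a \<in> Field t" "b \<in> Field t" using ab(1) lin_Field by auto
  have "ivl a b \<subseteq> Field t" using lin_Field by (auto simp: ivl_def)
  then have "infinite (rep ` ivl a b)"
    using infinite_reps ab close_iff by metis
  then have "infinite (rep ` ivl a b - {rep a, rep b})" by simp
  then obtain s where "s \<in> rep ` ivl a b - {rep a, rep b}"
    using infinite_imp_nonempty by (metis ex_in_conv)
  then obtain c where c: "(a, c) \<in> lin" "(c, b) \<in> lin" "s = rep c" "rep c \<noteq> rep a" "rep c \<noteq> rep b"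
    by (auto simp: ivl_def)
  have cF: "c \<in> Field t" using c(1) lin_Field by auto
  note s = rep[OF cF, folded c(3)]
  have ac: "\<not> close a c" "\<not> close c b" using c(4,5) rep_eq_iff[OF F(1) cF] rep_eq_iff[OF cF F(2)] by auto
  then have as: "\<not> close a s" "\<not> close s b"
    using close_trans[OF _ close_sym[OF s(2)] s(1)] close_trans[OF s(2) _ s(1)] by auto
  \<comment> \<open>The representative may sit anywhere in the class of \<open>c\<close>; since
    classes are convex and \<open>c\<close> is close to neither endpoint, it cannot leave the
    interval.\<close>
  have "(a, s) \<in> lin"
    using lin_total[OF F(1) s(1)] close_between(2)[OF close_sym[OF s(2)] _ c(1)] ac(1) by auto
  moreover have "(s, b) \<in> lin"
    using lin_total[OF s(1) F(2)] close_between(1)[OF s(2) c(2)] ac(2) by auto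
  ultimately show ?thesis
    using that as c(3) cF by (auto simp: reps_def)
qed

section \<open>The line of representatives\<close>

definition line :: "'a rel" where
  "line = Restr lin reps"

lemma Field_line: "Field line = reps"
proof
  show "Field line \<subseteq> reps" by (auto simp: line_def Field_def)
  show "reps \<subseteq> Field line"
    using reps_Field t_refl lin_of_t by (auto simp: line_def intro!: FieldI1)
qed

sublocale line: linear_order_space line
  by unfold_locales (simp add: line_def Linear_order_Restr Linear_order_lin)

lemma line_lt_iff: "line.lt x y \<longleftrightarrow> x \<in> reps \<and> y \<in> reps \<and> (x, y) \<in> lin \<and> x \<noteq> y"
  unfolding line.lt_def unfolding line_def by auto

lemma line_lt_not_close: "line.lt x y \<Longrightarrow> \<not> close x y"
  using reps_not_close by (simp add: line_lt_iff)

lemma line_ltI: "x \<in> reps \<Longrightarrow> y \<in> reps \<Longrightarrow> (x, y) \<in> lin \<Longrightarrow> \<not> close x y \<Longrightarrow> line.lt x y"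
  using close_refl reps_Field by (auto simp: line_lt_iff)

lemma exists_not_close:
  assumes "A \<subseteq> Field t" "\<not> |A| <o \<kappa>"
  obtains a b where "a \<in> A" "b \<in> A" "(a, b) \<in> lin" "\<not> close a b"
proof -
  obtain x where x: "x \<in> rep ` A"
    using infinite_reps[OF assms] infinite_imp_nonempty by (metis ex_in_conv)
  have "infinite (rep ` A - {x})"
    using infinite_reps[OF assms] by simp
  then obtain y where y: "y \<in> rep ` A - {x}"
    using infinite_imp_nonempty by (metis ex_in_conv)
  obtain a b where "a \<in> A" "b \<in> A" "rep a \<noteq> rep b" using x y by auto
  then have "\<not> close a b" "\<not> close b a" "(a, b) \<in> lin \<or> (b, a) \<in> lin"
    using rep_eq_iff[of a b] rep_eq_iff[of b a] lin_total[of a b] assms(1) by auto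
  then show ?thesis using that \<open>a \<in> A\<close> \<open>b \<in> A\<close> by metis
qed

lemma line_dense:
  assumes "line.lt x y"
  shows "\<exists>z. line.lt x z \<and> line.lt z y"
proof -
  have xy: "x \<in> reps" "y \<in> reps" "(x, y) \<in> lin"
    using assms by (auto simp: line_lt_iff)
  obtain s where "s \<in> reps" "(x, s) \<in> lin" "(s, y) \<in> lin" "\<not> close x s" "\<not> close s y"
    using rep_between[OF xy(3) line_lt_not_close[OF assms]] .
  then show ?thesis using line_ltI xy by metis
qed

lemma crowded_line: "crowded line.L"
proof (rule line.crowded_dense_order[OF line_dense])
  fix x assume "x \<in> Field line"
  obtain a b where ab: "a \<in> Field t" "b \<in> Field t" "(a, b) \<in> lin" "\<not> close a b"
    using exists_not_close[OF subset_refl large] .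
  then have "rep a \<noteq> rep b" "rep a \<in> reps" "rep b \<in> reps"
    using rep_eq_iff by (auto simp: reps_def)
  then show "\<exists>y\<in>Field line. y \<noteq> x"
    unfolding Field_line by metis
qed

text \<open>A non-empty open set of the line contains an interval whose endpoints are not close; in the tree
  order this interval is not a chain, so it contains the whole cone above one of its nodes. Cones
  of disjoint sets have incomparable roots.\<close>

lemma cellular_line:
  assumes F: "cellular_family line.L F"
  shows "|F| <o \<kappa>"
proof -
  define root where "root U a s s' \<longleftrightarrow> s \<in> U \<and> s' \<in> U \<and>
      (\<forall>z\<in>reps. (s, z) \<in> lin \<longrightarrow> (z, s') \<in> lin \<longrightarrow> z \<in> U) \<and>
      a \<in> Field t \<and> (\<forall>u. (a, u) \<in> t \<longrightarrow> (s, u) \<in> lin \<and> (u, s') \<in> lin)" for U a s s'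
  have "\<exists>a s s'. root U a s s'" if U: "U \<in> F" for U
  proof -
    have openU: "openin line.L U" "U \<noteq> {}"
      using F U by (auto simp: cellular_family_def)
    then obtain x where x: "x \<in> U" by auto
    obtain J where J: "openin line.L J" "line.cvx J" "x \<in> J" "J \<subseteq> U"
      using line.convex_neighbourhood[OF openU(1) x] by auto
    obtain y where y: "y \<in> J" "y \<noteq> x"
      using crowded_point[OF crowded_line J(1,3)] .
    have JF: "J \<subseteq> reps" using J(2) by (simp add: line.cvx_def Field_line)
    obtain s s' where s: "s \<in> J" "s' \<in> J" "line.lt s s'"
      using line.lt_linear[of x y] y J(3) JF unfolding Field_line by (metis subsetD)
    then have ss': "s \<in> reps" "s' \<in> reps" "(s, s') \<in> lin"
      by (auto simp: line_lt_iff)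
    then have "\<not> |ivl s s'| <o \<kappa>"
      using line_lt_not_close[OF s(3)] close_iff by metis
    then have "ivl s s' \<notin> Chains t" using chains by metis
    then obtain a b where ab: "a \<in> ivl s s'" "b \<in> ivl s s'" "(a, b) \<notin> t" "(b, a) \<notin> t"
      unfolding Chains_def by auto
    have abF: "a \<in> Field t" "b \<in> Field t" using ab lin_Field by (auto simp: ivl_def)
    have cone: "\<exists>a. a \<in> Field t \<and> (\<forall>u. (a, u) \<in> t \<longrightarrow> (s, u) \<in> lin \<and> (u, s') \<in> lin)"
      if "a \<in> ivl s s'" "b \<in> ivl s s'" "(a, b) \<notin> t" "(a, b) \<in> lin" for a b
    proof (intro exI conjI allI impI)
      show "a \<in> Field t" using that(4) lin_Field by auto
      fix u assume u: "(a, u) \<in> t"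
      have "(s, a) \<in> lin" "(b, s') \<in> lin"
        using that(1,2) by (auto simp: ivl_def)
      then show "(s, u) \<in> lin" "(u, s') \<in> lin"
        using cone_subset_interval[OF that(4,3) u] lin_trans by metis+
    qed
    then obtain c where "c \<in> Field t" "\<forall>u. (c, u) \<in> t \<longrightarrow> (s, u) \<in> lin \<and> (u, s') \<in> lin"
      using lin_total[OF abF] ab by metis
    moreover have "z \<in> U" if "z \<in> reps" "(s, z) \<in> lin" "(z, s') \<in> lin" for z
      using line.cvxD[OF J(2) s(1,2), of z] that ss' J(4) by (auto simp: line_def)
    ultimately have "root U c s s'"
      using s(1,2) J(4) unfolding root_def by auto
    then show ?thesis by metis
  qed
  then obtain a s s' where "\<And>U. U \<in> F \<Longrightarrow> root U (a U) (s U) (s' U)"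
    by metis
  then have s: "\<And>U. U \<in> F \<Longrightarrow> s U \<in> U" "\<And>U. U \<in> F \<Longrightarrow> s' U \<in> U"
    and fill: "\<And>U z. U \<in> F \<Longrightarrow> z \<in> reps \<Longrightarrow> (s U, z) \<in> lin \<Longrightarrow> (z, s' U) \<in> lin \<Longrightarrow> z \<in> U"
    and a: "\<And>U. U \<in> F \<Longrightarrow> a U \<in> Field t"
    and cone: "\<And>U u. U \<in> F \<Longrightarrow> (a U, u) \<in> t \<Longrightarrow> (s U, u) \<in> lin \<and> (u, s' U) \<in> lin"
    unfolding root_def by metis+
  have incomparable: "U = V" if UV: "U \<in> F" "V \<in> F" "(a U, a V) \<in> t" for U V
  proof (rule ccontr)
    assume "U \<noteq> V"
    then have disj: "disjnt U V" using F UV(1,2) by (auto simp: cellular_family_def pairwise_def)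
    have "U \<subseteq> reps" "V \<subseteq> reps"
      using F UV(1,2) openin_subset unfolding cellular_family_def
      by (metis topspace_order_topology_of Field_line)+
    then have R: "s U \<in> reps" "s V \<in> reps" using s UV by auto
    have le: "(s U, a V) \<in> lin" "(a V, s' U) \<in> lin" "(s V, a V) \<in> lin" "(a V, s' V) \<in> lin"
      using cone[OF UV(1,3)] cone[OF UV(2) t_refl[OF a[OF UV(2)]]] by auto
    \<comment> \<open>The node \<open>a V\<close> lies in both intervals but need not be a point of
      the line. The larger of the two left endpoints is one, and it lies in \<open>U\<close> and in
      \<open>V\<close>.\<close>
    have "(s U, s V) \<in> lin \<or> (s V, s U) \<in> lin"
      using lin_total R reps_Field by auto
    then have "s V \<in> U \<or> s U \<in> V"
      using fill[OF UV(1) R(2)] fill[OF UV(2) R(1)] le lin_trans by metis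
    then show False
      using s UV(1,2) disj by (auto simp: disjnt_def)
  qed
  have "inj_on a F"
    using incomparable a t_refl by (metis inj_onI)
  moreover have "antichain_in t (a ` F)"
    using incomparable a by (auto simp: antichain_in_def)
  then have "|a ` F| <o \<kappa>" by (rule antichains)
  ultimately show ?thesis
    using card_of_ordIsoI[OF inj_on_imp_bij_betw] ordIso_ordLess_trans by metis
qed

text \<open>The nodes below a small set \<open>D\<close> are few, so some large cone misses \<open>D\<close>, and the cone contains an
  open interval of the line.\<close>

lemma line_dense_subset_large:
  assumes D: "dense_subset line.L D"
  shows "\<not> |D| <o \<kappa>"
proof
  assume small: "|D| <o \<kappa>"
  have DF: "D \<subseteq> Field t"
    using D reps_Field by (auto simp: dense_subset_def topspace_order_topology_of Field_line)
  define N where "N = (\<Union>d\<in>D. {u. (u, d) \<in> t})"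
  have "{u. (u, d) \<in> t} \<in> Chains t" for d
    using t_comparable by (auto simp: Chains_def)
  then have "|N| <o \<kappa>"
    unfolding N_def using chains by (intro stable_UNION[OF stable small]) auto
  \<comment> \<open>Removing a small set leaves a large one, which is covered by fewer than \<kappa>
    cones over its minimal nodes; by regularity one of these cones is large. Its root
    \<open>m\<close> is outside \<open>N\<close>, so the cone misses \<open>D\<close>.\<close>
  then have "\<not> |Field t - N| <o \<kappa>"
    using large small_Un[of N "Field t - N"] small_subset[of "Field t" "N \<union> (Field t - N)"] by auto
  moreover obtain M where M: "M \<subseteq> Field t - N" "antichain_in t M"
      "\<And>p. p \<in> Field t - N \<Longrightarrow> \<exists>m\<in>M. (m, p) \<in> t"
    by (rule minimal_antichain[of "Field t - N"]) auto
  have "Field t - N \<subseteq> (\<Union>m\<in>M. {u. (m, u) \<in> t})"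
    using M(3) by auto
  ultimately have "\<not> |\<Union>m\<in>M. {u. (m, u) \<in> t}| <o \<kappa>"
    using small_subset by metis
  then obtain m where m: "m \<in> M" "\<not> |{u. (m, u) \<in> t}| <o \<kappa>"
    using stable_UNION[OF stable antichains[OF M(2)], of "\<lambda>m. {u. (m, u) \<in> t}"] by metis
  have "{u. (m, u) \<in> t} \<subseteq> Field t" using t_Field(2) by auto
  then obtain a b where ab: "a \<in> {u. (m, u) \<in> t}" "b \<in> {u. (m, u) \<in> t}" "(a, b) \<in> lin" "\<not> close a b"
    using exists_not_close m(2) by metis
  \<comment> \<open>Three representatives between \<open>a\<close> and \<open>b\<close>: the outer
    two bound an open interval of the line, and the middle one shows that it is non-empty.\<close>
  obtain s2 where s2: "s2 \<in> reps" "(a, s2) \<in> lin" "(s2, b) \<in> lin" "\<not> close a s2" "\<not> close s2 b"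
    using rep_between[OF ab(3,4)] .
  obtain s1 where s1: "s1 \<in> reps" "(a, s1) \<in> lin" "(s1, s2) \<in> lin" "\<not> close a s1" "\<not> close s1 s2"
    using rep_between[OF s2(2,4)] .
  obtain s3 where s3: "s3 \<in> reps" "(s2, s3) \<in> lin" "(s3, b) \<in> lin" "\<not> close s2 s3" "\<not> close s3 b"
    using rep_between[OF s2(3,5)] .
  let ?V = "{z. line.lt s1 z} \<inter> {z. line.lt z s3}"
  have "openin line.L ?V"
    using line.openin_upper_ray[of s1] line.openin_lower_ray[of s3] s1(1) s3(1)
    by (intro openin_Int) (auto simp: Field_line)
  moreover have "s2 \<in> ?V"
    using line_ltI s1 s2 s3 by auto
  ultimately have "D \<inter> ?V \<noteq> {}"
    using D unfolding dense_subset_def dense_intersects_open by (metis empty_iff)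
  then obtain d where d: "d \<in> D" "line.lt s1 d" "line.lt d s3" by auto
  then have "(a, d) \<in> lin" "(d, b) \<in> lin"
    using s1(2) s3(3) lin_trans unfolding line_lt_iff by metis+
  \<comment> \<open>Convexity of the cone puts the point \<open>d\<close> of \<open>D\<close> above
    \<open>m\<close>, so \<open>m\<close> would belong to \<open>N\<close>.\<close>
  then have "(m, d) \<in> t"
    using cone_convex[of m a b d] ab(1,2) by auto
  then have "m \<in> N" using d(1) by (auto simp: N_def)
  then show False using m(1) M(1) by auto
qed

lemma Suslin_line_line: "Suslin_line \<kappa> line"
  unfolding Suslin_line_def
proof (intro conjI)
  show "Linear_order line" by (rule line.linear)
  show "crowded line.L" by (rule crowded_line)
  have card: "Card_order \<kappa>" using inf by simp
  obtain D where D: "dense_subset line.L D" "|D| =o density line.L"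
    using density(2) by metis
  have "\<kappa> \<le>o |D|"
    using line_dense_subset_large[OF D(1)] not_ordLess_card[OF card] by metis
  then show "\<kappa> \<le>o density line.L"
    using D(2) by (rule ordLeq_ordIso_trans)
  \<comment> \<open>The first half of the theorem is applied to the line itself: with smaller
    cellularity it would have a nowhere constant image of weight below \<kappa>, hence a dense set
    of size below \<kappa>.\<close>
  have "\<not> chat line.L <o \<kappa>"
  proof
    assume less: "chat line.L <o \<kappa>"
    obtain Y :: "'a topology" where Y: "tychonov Y" "nowhere_constant_image line.L Y" "weight Y \<le>o chat line.L"
      using nowhere_constant_image_weight_le_chat[OF crowded_line line.tychonov_L] by metis
    obtain f where f: "continuous_map line.L Y f" "nowhere_constant line.L f"
      using Y(2) unfolding nowhere_constant_image_def by metis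
    obtain B where B: "base_of Y B" "|B| =o weight Y" using weight(2) by metis
    have "|B| <o \<kappa>"
      using ordIso_ordLess_trans[OF B(2) ordLeq_ordLess_trans[OF Y(3) less]] .
    then have "\<exists>D. dense_subset line.L D \<and> |D| <o \<kappa>"
      using Y(1) cellular_line unfolding tychonov_def
      by (intro line.small_dense_subset[OF crowded_line f _ B(1) inf regular]) auto
    then show False using line_dense_subset_large by metis
  qed
  moreover have "chat line.L \<le>o \<kappa>"
    using cellular_line by (intro chat_leI card)
  ultimately show "chat line.L =o \<kappa>"
    using ordLeq_iff_ordLess_or_ordIso by metis
qed

end

section \<open>Closing the cycle of implications\<close>

lemma Suslin_line_of_Suslin_tree:
  fixes \<kappa> :: "'k rel" and T :: "'a rel"
  assumes "uncountable_regular \<kappa>" "Suslin_tree \<kappa> T"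
  shows "\<exists>L :: 'a rel. Suslin_line \<kappa> L"
proof -
  have \<kappa>: "Card_order \<kappa>" "natLeq <o \<kappa>" "regularCard \<kappa>"
    using assms(1) by (auto simp: uncountable_regular_def)
  have inf: "Cinfinite \<kappa>"
    using cinfinite_mono[OF ordLess_imp_ordLeq[OF \<kappa>(2)] natLeq_cinfinite] \<kappa>(1) by simp
  obtain w :: "'a rel" where "well_order_on UNIV w"
    using well_order_on by metis
  then have w: "trans w" "antisym w" "total_on UNIV w"
    by (simp_all add: order_on_defs)
  have "\<not> |Field T| <o \<kappa>"
    using card_Suslin_tree[OF \<kappa>(1) assms(2)] not_ordLess_card[OF \<kappa>(1)] by metis
  moreover have "is_tree T" "\<And>C. C \<in> Chains T \<Longrightarrow> |C| <o \<kappa>" "\<And>A. antichain_in T A \<Longrightarrow> |A| <o \<kappa>"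
    using assms(2) by (simp_all add: Suslin_tree_def)
  ultimately interpret large_ordered_tree T w \<kappa>
    using w inf \<kappa>(3) by unfold_locales
  show ?thesis using Suslin_line_line by metis
qed

theorem theoremA:
  shows "(\<forall>X :: 'a topology. crowded X \<and> tychonov X \<longrightarrow>
            (\<exists>Y :: 'a topology. crowded Y \<and> tychonov Y \<and> nowhere_constant_image X Y \<and>
               weight Y \<le>o chat X))
       \<and> (\<forall>\<kappa> :: 'k rel. uncountable_regular \<kappa> \<longrightarrow>
            ((\<forall>X :: 'a topology. crowded X \<and> tychonov X \<and> chat X =o \<kappa> \<longrightarrow>
                (\<exists>Y :: 'a topology. crowded Y \<and> tychonov Y \<and> nowhere_constant_image X Y \<and>
                   weight Y <o \<kappa>))
              \<longleftrightarrow> \<not> (\<exists>L :: 'a rel. Suslin_line \<kappa> L))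
          \<and> (\<not> (\<exists>L :: 'a rel. Suslin_line \<kappa> L) \<longleftrightarrow> \<not> (\<exists>T :: 'a rel. Suslin_tree \<kappa> T)))"
proof (intro conjI allI impI)
  show "\<exists>Y :: 'a topology. crowded Y \<and> tychonov Y \<and> nowhere_constant_image X Y \<and> weight Y \<le>o chat X"
    if "crowded X \<and> tychonov X" for X :: "'a topology"
    using that by (intro nowhere_constant_image_weight_le_chat) auto
next
  fix \<kappa> :: "'k rel" assume \<kappa>: "uncountable_regular \<kappa>"
  let ?images = "\<forall>X :: 'a topology. crowded X \<and> tychonov X \<and> chat X =o \<kappa> \<longrightarrow>
    (\<exists>Y :: 'a topology. crowded Y \<and> tychonov Y \<and> nowhere_constant_image X Y \<and> weight Y <o \<kappa>)"
  have no_tree: ?images if "\<not> (\<exists>T :: 'a rel. Suslin_tree \<kappa> T)"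
    using nowhere_constant_image_weight_less[OF _ _ _ \<kappa> that] by metis
  have no_line: "\<not> (\<exists>L :: 'a rel. Suslin_line \<kappa> L)" if images: ?images
  proof
    assume "\<exists>L :: 'a rel. Suslin_line \<kappa> L"
    then obtain L :: "'a rel" where L: "Suslin_line \<kappa> L" by metis
    then interpret linear_order_space L
      by unfold_locales (simp add: Suslin_line_def)
    obtain Y :: "'a topology" where "tychonov Y" "nowhere_constant_image (order_topology_of L) Y" "weight Y <o \<kappa>"
      using images L tychonov_L unfolding Suslin_line_def by metis
    then show False
      using Suslin_line_no_small_image[OF L \<kappa>] by (auto simp: tychonov_def)
  qed
  have tree: "\<exists>L :: 'a rel. Suslin_line \<kappa> L" if "\<exists>T :: 'a rel. Suslin_tree \<kappa> T"
    using that Suslin_line_of_Suslin_tree[OF \<kappa>] by metis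
  show "?images \<longleftrightarrow> \<not> (\<exists>L :: 'a rel. Suslin_line \<kappa> L)"
    using no_tree no_line tree by argo
  show "\<not> (\<exists>L :: 'a rel. Suslin_line \<kappa> L) \<longleftrightarrow> \<not> (\<exists>T :: 'a rel. Suslin_tree \<kappa> T)"
    using no_tree no_line tree by argo
qed

end
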